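(* Let $n\ge1$ and let $(\mathbb{Z}_n,\vartheta)$ be a completely degenerate cyclic quadratic group; for each divisor $l$ of $n$ let $H_l$ be the subgroup of $\mathbb{Z}_n$ of order $l$. Then: (1) every admissible weighted permutation action (WPA) of $(\mathbb{Z}_n,\vartheta)$ is equivalent to $\bigoplus_{l\mid n} m_l\,\mathcal{A}[H_l]$ for some non-negative integers $m_l$; (2) up to equivalence, the irreducible WPAs of $(\mathbb{Z}_n,\vartheta)$ are exactly the admissible coset WPAs $\mathcal{A}[H_l]$, $l\mid n$; (3) let $\alpha$ be a generator of $\mathbb{Z}_n$. If $\vartheta(\alpha)=1$, then $\mathcal{A}[H_l]$ has degree $(n/l)^2$ for every $l\mid n$. If $\vartheta(\alpha)=-1$ (so $n$ is even), then $\mathcal{A}[H_l]$ has degree $(n/l)^2$ if $l$ divides $n/2$ and degree $3(n/l)^2$ if $l$ does not divide $n/2$ (equivalently, if $n/l$ is odd).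
   Context: Groups are written multiplicatively; $\le$ means "subgroup of" (equality allowed); $\widehat G$ is the group of homomorphisms $G\to\mathbb{C}^*$. Quadratic groups. A quadratic group $(G,\vartheta)$ is a finite abelian group $G$ with $\vartheta:G\to\mathbb{C}^*$ satisfying $\vartheta(\alpha\beta)\vartheta(\beta\gamma)\vartheta(\gamma\alpha)=\vartheta(\alpha)\vartheta(\beta)\vartheta(\gamma)\vartheta(\alpha\beta\gamma)$ and $\vartheta(\alpha^n)=\vartheta(\alpha)^{n^2}$ for all $\alpha,\beta,\gamma\in G$, $n\in\mathbb{Z}$. It is completely degenerate if $\vartheta(\alpha\beta)=\vartheta(\alpha)\vartheta(\beta)$ for all $\alpha,\beta\in G$; equivalently, $\vartheta$ is a $\pm1$-valued character of $G$. From now on $(G,\vartheta)$ is completely degenerate. WPAs. A weighted permutation action (WPA) of $(G,\vartheta)$ is a pair $\Phi=(X,\omega)$ where $X$ (the support) is a finite set on which $G$ acts by permutations and $\omega:X\to\mathbb{C}^*$ satisfies $\frac{\omega(\alpha p)\,\omega(\beta p)}{\omega(p)\,\omega(\alpha\beta p)}=\frac{\vartheta(\alpha)\vartheta(\beta)}{\vartheta(\alpha\beta)}$ for all $p\in X$, $\alpha,\beta\in G$ (the right-hand side is $1$ in the completely degenerate case). The degree of $\Phi$ is $|X|$. Direct sum $\oplus$ is disjoint union of supports with the obvious action and weight; $n\Phi$ is the direct sum of $n$ copies of $\Phi$. Two WPAs $(X,\omega)$, $(X',\omega')$ are equivalent if there is a $G$-equivariant bijection $f:X\to X'$ such that $\omega'(f(p))/\omega(p)$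 is constant on each $G$-orbit. Coset WPAs. For $\xi\in\widehat G$ and $H\le\ker(\xi\vartheta)$, $\mathcal{W}[H,\xi]$ denotes (the equivalence class of) the WPA with support $G/H$, $G$ acting by translations, and weight $\omega(\alpha H)=\vartheta(\alpha)/\xi(\alpha)$. Every WPA is equivalent to a direct sum of coset WPAs $\bigoplus_i n_i\mathcal{W}[H_i,\xi_i]$ with uniquely determined multiplicities (over distinct pairs $(H_i,\xi_i)$). The function $\Upsilon$. For $\Phi=(X,\omega)$ and $\alpha,\beta\in G$, let $\mathrm{Fix}_\Phi(\alpha)=\{p\in X:\alpha p=p\}$ and $\Upsilon_\Phi(\alpha,\beta)=\vartheta(\beta)\sum_{p\in \mathrm{Fix}_\Phi(\alpha)}\frac{\omega(p)}{\omega(\beta p)}$. Admissibility. $\Phi$ is Galois invariant if, in its decomposition into coset WPAs, the multiplicities of $\mathcal{W}[H,\xi]$ and $\mathcal{W}[H,\xi^l]$ are equal for every $(H,\xi)$ and every integer $l$ coprime to the exponent of $G$. $\Phi$ satisfies reciprocity if $\Upsilon_\Phi(\alpha,\beta)=\Upsilon_\Phi(\beta,\alpha)$ for all $\alpha,\beta\in G$. $\Phi$ satisfies boundedness if $|\Upsilon_\Phi(\alpha,\beta)|\le|\mathrm{Fix}_\Phi(\alpha)\cap \mathrm{Fix}_\Phi(\beta)|$ for all $\alpha,\beta\in G$. $\Phi$ is admissible if it satisfies all three. A (non-empty) admissible WPA is irreducible if it is not equivalent to a direct sum of two non-empty admissible WPAs. Admissible coset WPAs. For $H\le G$ put $H_0=H\cap\ker\vartheta$.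 If $H\ne H_0$, $$\mathcal{A}[H]=\Big(\bigoplus_{\phi\in\widehat G,\ H\le\ker(\vartheta\phi)}\mathcal{W}[H,\phi]\Big)\oplus\Big(\bigoplus_{\phi\in\widehat G,\ H\le\ker\phi}\mathcal{W}[H_0,\phi]\Big);$$ if $H=H_0$, then $\mathcal{A}[H]=\bigoplus_{\phi\in\widehat G,\ H\le\ker\phi}\mathcal{W}[H,\phi]$. *)

theory Defs
  imports Complex_Main "HOL-Algebra.Algebra" "HOL-Algebra.Left_Coset"
begin

definition Cstar :: "complex monoid" where
  "Cstar = \<lparr>carrier = UNIV - {0}, monoid.mult = (*), one = 1\<rparr>"

text \<open>Characters are normalised to be \<^const>\<open>undefined\<close> off the carrier, so that the dual group
  really has one element per homomorphism.\<close>

definition dual :: "('a, 'm) monoid_scheme \<Rightarrow> ('a \<Rightarrow> complex) set" where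
  "dual G = hom G Cstar \<inter> extensional (carrier G)"

definition char_pow ::
    "('a, 'm) monoid_scheme \<Rightarrow> ('a \<Rightarrow> complex) \<Rightarrow> int \<Rightarrow> ('a \<Rightarrow> complex)" where
  "char_pow G \<xi> l = (\<lambda>\<alpha>\<in>carrier G. \<xi> \<alpha> powi l)"

definition group_exponent :: "('a, 'm) monoid_scheme \<Rightarrow> nat" where
  "group_exponent G = (LEAST e. 0 < e \<and> (\<forall>\<alpha>\<in>carrier G. \<alpha> [^]\<^bsub>G\<^esub> e = \<one>\<^bsub>G\<^esub>))"

section \<open>Quadratic groups\<close>

definition quadratic_group :: "('a, 'm) monoid_scheme \<Rightarrow> ('a \<Rightarrow> complex) \<Rightarrow> bool" where
  "quadratic_group G \<theta> \<longleftrightarrow>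
     comm_group G \<and> finite (carrier G) \<and>
     (\<forall>\<alpha>\<in>carrier G. \<theta> \<alpha> \<noteq> 0) \<and>
     (\<forall>\<alpha>\<in>carrier G. \<forall>\<beta>\<in>carrier G. \<forall>\<gamma>\<in>carrier G.
        \<theta> (\<alpha> \<otimes>\<^bsub>G\<^esub> \<beta>) * \<theta> (\<beta> \<otimes>\<^bsub>G\<^esub> \<gamma>) * \<theta> (\<gamma> \<otimes>\<^bsub>G\<^esub> \<alpha>)
        = \<theta> \<alpha> * \<theta> \<beta> * \<theta> \<gamma> * \<theta> (\<alpha> \<otimes>\<^bsub>G\<^esub> \<beta> \<otimes>\<^bsub>G\<^esub> \<gamma>)) \<and>
     (\<forall>\<alpha>\<in>carrier G. \<forall>k::int. \<theta> (\<alpha> [^]\<^bsub>G\<^esub> k) = \<theta> \<alpha> powi (k\<^sup>2))"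

definition completely_degenerate :: "('a, 'm) monoid_scheme \<Rightarrow> ('a \<Rightarrow> complex) \<Rightarrow> bool" where
  "completely_degenerate G \<theta> \<longleftrightarrow>
     (\<forall>\<alpha>\<in>carrier G. \<forall>\<beta>\<in>carrier G. \<theta> (\<alpha> \<otimes>\<^bsub>G\<^esub> \<beta>) = \<theta> \<alpha> * \<theta> \<beta>)"

section \<open>Weighted permutation actions\<close>

record ('a, 'x) wpa =
  support :: "'x set"
  action :: "'a \<Rightarrow> 'x \<Rightarrow> 'x"
  weight :: "'x \<Rightarrow> complex"

definition is_wpa ::
    "('a, 'm) monoid_scheme \<Rightarrow> ('a \<Rightarrow> complex) \<Rightarrow> ('a, 'x) wpa \<Rightarrow> bool" where
  "is_wpa G \<theta> \<Phi> \<longleftrightarrow>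
     finite (support \<Phi>) \<and>
     group_action G (support \<Phi>) (action \<Phi>) \<and>
     (\<forall>p\<in>support \<Phi>. weight \<Phi> p \<noteq> 0) \<and>
     (\<forall>p\<in>support \<Phi>. \<forall>\<alpha>\<in>carrier G. \<forall>\<beta>\<in>carrier G.
        weight \<Phi> (action \<Phi> \<alpha> p) * weight \<Phi> (action \<Phi> \<beta> p)
          / (weight \<Phi> p * weight \<Phi> (action \<Phi> (\<alpha> \<otimes>\<^bsub>G\<^esub> \<beta>) p))
        = \<theta> \<alpha> * \<theta> \<beta> / \<theta> (\<alpha> \<otimes>\<^bsub>G\<^esub> \<beta>))"

definition wpa_degree :: "('a, 'x) wpa \<Rightarrow> nat" where
  "wpa_degree \<Phi> = card (support \<Phi>)"

definition wpa_equiv ::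
    "('a, 'm) monoid_scheme \<Rightarrow> ('a, 'x) wpa \<Rightarrow> ('a, 'y) wpa \<Rightarrow> bool" where
  "wpa_equiv G \<Phi> \<Psi> \<longleftrightarrow>
     (\<exists>f. bij_betw f (support \<Phi>) (support \<Psi>) \<and>
        (\<forall>\<alpha>\<in>carrier G. \<forall>p\<in>support \<Phi>. f (action \<Phi> \<alpha> p) = action \<Psi> \<alpha> (f p)) \<and>
        (\<forall>Orb\<in>orbits G (support \<Phi>) (action \<Phi>).
           \<exists>c. \<forall>p\<in>Orb. weight \<Psi> (f p) / weight \<Phi> p = c))"

text \<open>Actions are restricted to the support because \<^const>\<open>group_action\<close> asks for extensional
  permutations.\<close>

definition wpa_plus :: "('a, 'x) wpa \<Rightarrow> ('a, 'y) wpa \<Rightarrow> ('a, 'x + 'y) wpa" where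
  "wpa_plus \<Phi> \<Psi> =
     \<lparr>support = support \<Phi> <+> support \<Psi>,
      action = (\<lambda>\<alpha>. \<lambda>p\<in>support \<Phi> <+> support \<Psi>. map_sum (action \<Phi> \<alpha>) (action \<Psi> \<alpha>) p),
      weight = case_sum (weight \<Phi>) (weight \<Psi>)\<rparr>"

definition wpa_sum :: "'i set \<Rightarrow> ('i \<Rightarrow> ('a, 'x) wpa) \<Rightarrow> ('a, 'i \<times> 'x) wpa" where
  "wpa_sum I \<Phi> =
     \<lparr>support = (SIGMA i:I. support (\<Phi> i)),
      action = (\<lambda>\<alpha>. \<lambda>(i, p)\<in>(SIGMA i:I. support (\<Phi> i)). (i, action (\<Phi> i) \<alpha> p)),
      weight = (\<lambda>(i, p). weight (\<Phi> i) p)\<rparr>"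

definition wpa_copies :: "nat \<Rightarrow> ('a, 'x) wpa \<Rightarrow> ('a, nat \<times> 'x) wpa" where
  "wpa_copies k \<Phi> = wpa_sum {..<k} (\<lambda>_. \<Phi>)"

section \<open>Coset WPAs\<close>

definition coset_pairs ::
    "('a, 'm) monoid_scheme \<Rightarrow> ('a \<Rightarrow> complex) \<Rightarrow> ('a set \<times> ('a \<Rightarrow> complex)) set" where
  "coset_pairs G \<theta> =
     {(H, \<xi>). subgroup H G \<and> \<xi> \<in> dual G \<and> H \<subseteq> kernel G Cstar (\<lambda>\<alpha>. \<xi> \<alpha> * \<theta> \<alpha>)}"

text \<open>In the completely degenerate case, for \<open>(H, \<xi>)\<close> in \<^const>\<open>coset_pairs\<close> the quotient
  \<open>\<theta> \<alpha> / \<xi> \<alpha>\<close> is constant as \<open>\<alpha>\<close> runs over a coset, so \<^const>\<open>the_elem\<close> picks its value.\<close>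

definition coset_wpa ::
    "('a, 'm) monoid_scheme \<Rightarrow> ('a \<Rightarrow> complex) \<Rightarrow> 'a set \<Rightarrow> ('a \<Rightarrow> complex) \<Rightarrow> ('a, 'a set) wpa" where
  "coset_wpa G \<theta> H \<xi> =
     \<lparr>support = lcosets\<^bsub>G\<^esub> H,
      action = (\<lambda>\<alpha>. \<lambda>C\<in>lcosets\<^bsub>G\<^esub> H. \<alpha> <#\<^bsub>G\<^esub> C),
      weight = (\<lambda>C. the_elem ((\<lambda>\<alpha>. \<theta> \<alpha> / \<xi> \<alpha>) ` C))\<rparr>"

definition is_coset_decomposition ::
    "('a, 'm) monoid_scheme \<Rightarrow> ('a \<Rightarrow> complex) \<Rightarrow> ('a, 'x) wpa \<Rightarrow>
     ('a set \<Rightarrow> ('a \<Rightarrow> complex) \<Rightarrow> nat) \<Rightarrow> bool" where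
  "is_coset_decomposition G \<theta> \<Phi> mu \<longleftrightarrow>
     wpa_equiv G \<Phi>
       (wpa_sum (coset_pairs G \<theta>) (\<lambda>(H, \<xi>). wpa_copies (mu H \<xi>) (coset_wpa G \<theta> H \<xi>)))"

section \<open>Admissibility\<close>

definition Fix :: "('a, 'x) wpa \<Rightarrow> 'a \<Rightarrow> 'x set" where
  "Fix \<Phi> \<alpha> = invariants (support \<Phi>) (action \<Phi>) \<alpha>"

definition Upsilon :: "('a \<Rightarrow> complex) \<Rightarrow> ('a, 'x) wpa \<Rightarrow> 'a \<Rightarrow> 'a \<Rightarrow> complex" where
  "Upsilon \<theta> \<Phi> \<alpha> \<beta> = \<theta> \<beta> * (\<Sum>p\<in>Fix \<Phi> \<alpha>. weight \<Phi> p / weight \<Phi> (action \<Phi> \<beta> p))"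

text \<open>A decomposition into coset WPAs exists and its multiplicities on \<^const>\<open>coset_pairs\<close> are
  unique, so the existential below speaks about ``the'' decomposition.\<close>

definition galois_invariant ::
    "('a, 'm) monoid_scheme \<Rightarrow> ('a \<Rightarrow> complex) \<Rightarrow> ('a, 'x) wpa \<Rightarrow> bool" where
  "galois_invariant G \<theta> \<Phi> \<longleftrightarrow>
     (\<exists>mu. is_coset_decomposition G \<theta> \<Phi> mu \<and>
        (\<forall>(H, \<xi>)\<in>coset_pairs G \<theta>. \<forall>l::int. coprime l (int (group_exponent G)) \<longrightarrow>
           mu H \<xi> = mu H (char_pow G \<xi> l)))"

definition reciprocity ::
    "('a, 'm) monoid_scheme \<Rightarrow> ('a \<Rightarrow> complex) \<Rightarrow> ('a, 'x) wpa \<Rightarrow> bool" where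
  "reciprocity G \<theta> \<Phi> \<longleftrightarrow>
     (\<forall>\<alpha>\<in>carrier G. \<forall>\<beta>\<in>carrier G. Upsilon \<theta> \<Phi> \<alpha> \<beta> = Upsilon \<theta> \<Phi> \<beta> \<alpha>)"

definition boundedness ::
    "('a, 'm) monoid_scheme \<Rightarrow> ('a \<Rightarrow> complex) \<Rightarrow> ('a, 'x) wpa \<Rightarrow> bool" where
  "boundedness G \<theta> \<Phi> \<longleftrightarrow>
     (\<forall>\<alpha>\<in>carrier G. \<forall>\<beta>\<in>carrier G.
        cmod (Upsilon \<theta> \<Phi> \<alpha> \<beta>) \<le> real (card (Fix \<Phi> \<alpha> \<inter> Fix \<Phi> \<beta>)))"

definition admissible ::
    "('a, 'm) monoid_scheme \<Rightarrow> ('a \<Rightarrow> complex) \<Rightarrow> ('a, 'x) wpa \<Rightarrow> bool" where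
  "admissible G \<theta> \<Phi> \<longleftrightarrow>
     is_wpa G \<theta> \<Phi> \<and> galois_invariant G \<theta> \<Phi> \<and> reciprocity G \<theta> \<Phi> \<and> boundedness G \<theta> \<Phi>"

text \<open>Up to equivalence, direct summands of \<open>\<Phi>\<close> are supported on subsets of the support of \<open>\<Phi>\<close>,
  so letting \<open>\<Psi>\<^sub>1\<close> and \<open>\<Psi>\<^sub>2\<close> range over WPAs with support in the same type loses nothing.\<close>

definition irreducible_wpa ::
    "('a, 'm) monoid_scheme \<Rightarrow> ('a \<Rightarrow> complex) \<Rightarrow> ('a, 'x) wpa \<Rightarrow> bool" where
  "irreducible_wpa G \<theta> \<Phi> \<longleftrightarrow>
     admissible G \<theta> \<Phi> \<and> support \<Phi> \<noteq> {} \<and>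
     \<not> (\<exists>(\<Psi>\<^sub>1 :: ('a, 'x) wpa) (\<Psi>\<^sub>2 :: ('a, 'x) wpa).
          admissible G \<theta> \<Psi>\<^sub>1 \<and> support \<Psi>\<^sub>1 \<noteq> {} \<and>
          admissible G \<theta> \<Psi>\<^sub>2 \<and> support \<Psi>\<^sub>2 \<noteq> {} \<and>
          wpa_equiv G \<Phi> (wpa_plus \<Psi>\<^sub>1 \<Psi>\<^sub>2))"

section \<open>Admissible coset WPAs\<close>

text \<open>For \<open>H \<noteq> H\<^sub>0\<close> the two families of pairs below are disjoint, as their first components differ;
  the sum over their union is therefore the direct sum of the two sums.\<close>

definition adm_coset_pairs ::
    "('a, 'm) monoid_scheme \<Rightarrow> ('a \<Rightarrow> complex) \<Rightarrow> 'a set \<Rightarrow> ('a set \<times> ('a \<Rightarrow> complex)) set" where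
  "adm_coset_pairs G \<theta> H =
     (let H\<^sub>0 = H \<inter> kernel G Cstar \<theta> in
      if H \<noteq> H\<^sub>0
      then {(H, \<phi>) | \<phi>. \<phi> \<in> dual G \<and> H \<subseteq> kernel G Cstar (\<lambda>\<alpha>. \<theta> \<alpha> * \<phi> \<alpha>)}
         \<union> {(H\<^sub>0, \<phi>) | \<phi>. \<phi> \<in> dual G \<and> H \<subseteq> kernel G Cstar \<phi>}
      else {(H, \<phi>) | \<phi>. \<phi> \<in> dual G \<and> H \<subseteq> kernel G Cstar \<phi>})"

definition adm_coset_wpa ::
    "('a, 'm) monoid_scheme \<Rightarrow> ('a \<Rightarrow> complex) \<Rightarrow> 'a set \<Rightarrow>
     ('a, ('a set \<times> ('a \<Rightarrow> complex)) \<times> 'a set) wpa" where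
  "adm_coset_wpa G \<theta> H = wpa_sum (adm_coset_pairs G \<theta> H) (\<lambda>(K, \<phi>). coset_wpa G \<theta> K \<phi>)"

end

theory Submission
  imports Defs
begin

text \<open>
  A point \<open>p\<close> of a WPA has a type: its stabiliser together with the character
  \<open>\<alpha> \<mapsto> \<theta> \<alpha> * \<omega> p / \<omega> (\<alpha> p)\<close>. Equivalence, \<open>\<Upsilon>\<close>, fixed points and Galois invariance all
  depend only on the numbers of points of each type. Since \<open>\<Upsilon> \<alpha> (\<alpha>\<beta>) = \<theta> \<alpha> * \<Upsilon> \<alpha> \<beta>\<close>, reciprocity
  and the Euclidean algorithm in a cyclic group turn \<open>\<Upsilon> \<alpha> \<beta>\<close> into a multiple of \<open>\<Upsilon> \<gamma> 1\<close> with
  \<open>\<gamma>\<close> generating \<open>\<langle>\<alpha>, \<beta>\<rangle>\<close>. By Fourier inversion a solution of the (linear) reciprocity equations is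
  then determined by its values at the types \<open>(K, \<theta>)\<close>. The type \<open>(K, \<theta>)\<close> occurs in \<open>\<A>[H]\<close>
  only for \<open>K = H\<close>, with multiplicity one, so an admissible WPA is the sum of the \<open>\<A>[H]\<close> taken
  with the multiplicities of \<open>\<W>[H,\<theta>]\<close> in it.
\<close>

section \<open>Characters\<close>

text \<open>The obstacle is that admissible actions cannot be subtracted. The uniqueness statement
  is therefore proved for arbitrary complex-valued functions \<open>D\<close> on the set of types,
  keeping only the linear condition that \<open>pairing D\<close> is symmetric; it is applied to the
  difference between an admissible action and the candidate sum of the A[H]. The shape of A[H] comes
  from this symmetry. In units of the squared index of H, the pairs (H, \<phi>) contribute \<theta>
  \<beta> to Upsilon on H \<times> H, which is not symmetric if \<theta> is nontrivial on H. The
  pairs (H_0, \<phi>) add 2 where \<theta> \<alpha> = 1 and 0 elsewhere on H, that is 1 + \<theta>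
  \<alpha>, and the total 1 + \<theta> \<alpha> + \<theta> \<beta> is symmetric. Its value 3 at the
  unit is the factor 3 in the degree. The types (K, \<theta>) serve as coordinates because \<theta>
  is the one character that is allowed with every subgroup K. They also give irreducibility: each
  non-empty admissible action contains a full orbit of some type (K, \<theta>), while A[H] contains
  only one such orbit in all.\<close>

locale degenerate_group = comm_group G for G :: "('a, 'm) monoid_scheme" (structure) +
  fixes \<theta> :: "'a \<Rightarrow> complex"
  assumes finite_carrier: "finite (carrier G)"
    and theta_mult: "\<lbrakk>\<alpha> \<in> carrier G; \<beta> \<in> carrier G\<rbrakk> \<Longrightarrow> \<theta> (\<alpha> \<otimes> \<beta>) = \<theta> \<alpha> * \<theta> \<beta>"
    and theta_square: "\<alpha> \<in> carrier G \<Longrightarrow> \<theta> \<alpha> * \<theta> \<alpha> = 1"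
begin

lemma theta_nonzero: "\<alpha> \<in> carrier G \<Longrightarrow> \<theta> \<alpha> \<noteq> 0"
  using theta_square by force

lemma theta_cases: "\<alpha> \<in> carrier G \<Longrightarrow> \<theta> \<alpha> = 1 \<or> \<theta> \<alpha> = - 1"
  using theta_square square_eq_1_iff by blast

lemma order_pos: "0 < order G"
  using finite_carrier order_gt_0_iff_finite by blast

lemma dual_iff:
  "\<xi> \<in> dual G \<longleftrightarrow> \<xi> \<in> extensional (carrier G) \<and> (\<forall>\<alpha>\<in>carrier G. \<xi> \<alpha> \<noteq> 0) \<and>
     (\<forall>\<alpha>\<in>carrier G. \<forall>\<beta>\<in>carrier G. \<xi> (\<alpha> \<otimes> \<beta>) = \<xi> \<alpha> * \<xi> \<beta>)"
  by (auto simp: dual_def hom_def Cstar_def)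

lemma dual_one: "\<xi> \<in> dual G \<Longrightarrow> \<xi> \<one> = 1"
  unfolding dual_iff by (metis mult_cancel_left2 one_closed r_one)

lemma dual_pow: "\<lbrakk>\<xi> \<in> dual G; \<alpha> \<in> carrier G\<rbrakk> \<Longrightarrow> \<xi> (\<alpha> [^] (k::nat)) = \<xi> \<alpha> ^ k"
  by (induction k) (auto simp: dual_one dual_iff)

lemma dual_root_of_unity: "\<lbrakk>\<xi> \<in> dual G; \<alpha> \<in> carrier G\<rbrakk> \<Longrightarrow> \<xi> \<alpha> ^ order G = 1"
  by (metis dual_one dual_pow pow_order_eq_1)

text \<open>All values are roots of unity of order dividing \<open>order G\<close>, and
  extensionality leaves only a finite function space.\<close>

lemma finite_dual: "finite (dual G)"
proof (rule finite_subset)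
  show "dual G \<subseteq> carrier G \<rightarrow>\<^sub>E {z. z ^ order G = 1}"
    by (intro subsetI) (simp add: PiE_iff dual_root_of_unity dual_iff[THEN iffD1])
  show "finite (carrier G \<rightarrow>\<^sub>E {z::complex. z ^ order G = 1})"
    using finite_carrier order_pos by (intro finite_PiE finite_roots_unity) auto
qed

lemma dual_mult:
  "\<lbrakk>\<xi> \<in> dual G; \<chi> \<in> dual G\<rbrakk> \<Longrightarrow> (\<lambda>\<alpha>\<in>carrier G. \<xi> \<alpha> * \<chi> \<alpha>) \<in> dual G"
  by (auto simp: dual_iff)

lemma dual_divide:
  "\<lbrakk>\<xi> \<in> dual G; \<chi> \<in> dual G\<rbrakk> \<Longrightarrow> (\<lambda>\<alpha>\<in>carrier G. \<xi> \<alpha> / \<chi> \<alpha>) \<in> dual G"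
  by (auto simp: dual_iff)

text \<open>\<open>\<theta>\<close> is arbitrary off the carrier, whereas elements of
  \<open>dual G\<close> are extensional; only the restriction can be the second component of a
  pair.\<close>

abbreviation theta_char :: "'a \<Rightarrow> complex" where
  "theta_char \<equiv> restrict \<theta> (carrier G)"

lemma theta_char_dual: "theta_char \<in> dual G"
  using theta_nonzero theta_mult by (auto simp: dual_iff)

lemma theta_one: "\<theta> \<one> = 1"
  using dual_one[OF theta_char_dual] by simp

lemma theta_inv: "\<alpha> \<in> carrier G \<Longrightarrow> \<theta> (inv \<alpha>) = \<theta> \<alpha>"
  using theta_mult[of \<alpha> "inv \<alpha>"] theta_cases[of \<alpha>] by (auto simp: theta_one minus_equation_iff)

lemma theta_pow: "\<alpha> \<in> carrier G \<Longrightarrow> \<theta> (\<alpha> [^] (k::nat)) = \<theta> \<alpha> ^ k"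
  using dual_pow[OF theta_char_dual, of \<alpha> k] by simp

lemma even_order:
  assumes "\<alpha> \<in> carrier G" "\<theta> \<alpha> = - 1"
  shows "even (order G)"
proof -
  have "(- 1 :: complex) ^ order G = 1"
    using theta_pow[OF assms(1), of "order G"] pow_order_eq_1[OF assms(1)] theta_one assms(2) by simp
  then show ?thesis by (metis minus_one_power_iff one_neq_neg_one)
qed

section \<open>Orthogonality of characters and indices of subgroups\<close>

lemma dual_eqI:
  "\<lbrakk>\<xi> \<in> dual G; \<chi> \<in> dual G; \<And>\<alpha>. \<alpha> \<in> carrier G \<Longrightarrow> \<xi> \<alpha> = \<chi> \<alpha>\<rbrakk> \<Longrightarrow> \<xi> = \<chi>"
  by (auto simp: dual_iff intro: extensionalityI)

lemma sum_dual_nontrivial: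
  assumes "\<xi> \<in> dual G" "\<gamma> \<in> carrier G" "\<xi> \<gamma> \<noteq> 1"
  shows "(\<Sum>\<alpha>\<in>carrier G. \<xi> \<alpha>) = 0"
proof -
  have "(\<Sum>\<alpha>\<in>carrier G. \<xi> \<alpha>) = (\<Sum>\<alpha>\<in>carrier G. \<xi> (\<gamma> \<otimes> \<alpha>))"
    by (rule sum.reindex_bij_witness[of _ "\<lambda>\<alpha>. \<gamma> \<otimes> \<alpha>" "\<lambda>\<alpha>. inv \<gamma> \<otimes> \<alpha>"])
       (use assms in \<open>auto simp: m_assoc[symmetric]\<close>)
  also have "\<dots> = \<xi> \<gamma> * (\<Sum>\<alpha>\<in>carrier G. \<xi> \<alpha>)"
    using assms by (simp add: dual_iff sum_distrib_left)
  finally show ?thesis using assms(3) by simp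
qed

text \<open>Dividing by \<open>\<chi>\<close> replaces the usual complex conjugation; the quotient
  is again a character, so the vanishing of a nontrivial character sum applies to it.\<close>

lemma dual_orthogonality:
  assumes "\<xi> \<in> dual G" "\<chi> \<in> dual G"
  shows "(\<Sum>\<alpha>\<in>carrier G. \<xi> \<alpha> / \<chi> \<alpha>) = (if \<xi> = \<chi> then of_nat (order G) else 0)"
proof (cases "\<xi> = \<chi>")
  case True
  then show ?thesis using assms by (simp add: dual_iff order_def)
next
  case False
  then obtain \<gamma> where \<gamma>: "\<gamma> \<in> carrier G" "\<xi> \<gamma> \<noteq> \<chi> \<gamma>"
    using assms dual_eqI by blast
  then have "(\<lambda>\<alpha>\<in>carrier G. \<xi> \<alpha> / \<chi> \<alpha>) \<gamma> \<noteq> 1"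
    using assms by (auto simp: dual_iff)
  from sum_dual_nontrivial[OF dual_divide[OF assms] \<gamma>(1) this] False show ?thesis
    by simp
qed

text \<open>This is the degree of \<open>coset_wpa G \<theta> K \<xi>\<close>, hence the use of left
  cosets. In the cyclic case it is also an exponent e for which the e-th power of the generator
  generates K.\<close>

definition index :: "'a set \<Rightarrow> nat" where
  "index K = card (lcosets K)"

lemma card_mult_index: "subgroup K G \<Longrightarrow> card K * index K = order G"
  unfolding index_def using l_lagrange[OF finite_carrier] by (simp add: mult.commute)

lemma index_eq: "subgroup K G \<Longrightarrow> index K = order G div card K"
  using card_mult_index[of K, symmetric] order_pos by (cases "card K = 0") simp_all

lemma index_pos: "subgroup K G \<Longrightarrow> 0 < index K"
  using card_mult_index order_pos by (metis gr0I mult_0_right)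

lemma card_subgroup_pos: "subgroup K G \<Longrightarrow> 0 < card K"
  using card_mult_index order_pos by (metis gr0I mult_0)

subsection \<open>Pairs of a subgroup and a character\<close>

abbreviation pairs :: "('a set \<times> ('a \<Rightarrow> complex)) set" where
  "pairs \<equiv> coset_pairs G \<theta>"

text \<open>Since \<theta> is its own inverse, triviality of the product of \<xi> and \<theta> on K
  becomes agreement of the two characters on K.\<close>

lemma pairs_iff:
  "(K, \<xi>) \<in> pairs \<longleftrightarrow> subgroup K G \<and> \<xi> \<in> dual G \<and> (\<forall>\<alpha>\<in>K. \<xi> \<alpha> = \<theta> \<alpha>)"
proof (cases "subgroup K G")
  case True
  then have "\<alpha> \<in> carrier G" if "\<alpha> \<in> K" for \<alpha>
    using that subgroup.subset by blast
  moreover have "\<xi> \<alpha> * \<theta> \<alpha> = 1 \<longleftrightarrow> \<xi> \<alpha> = \<theta> \<alpha>" if "\<alpha> \<in> carrier G" for \<alpha>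
    using theta_cases[OF that] by (auto simp: minus_equation_iff)
  ultimately show ?thesis
    by (auto simp: coset_pairs_def kernel_def Cstar_def subset_iff)
qed (simp add: coset_pairs_def)

lemma finite_pairs: "finite pairs"
proof (rule finite_subset)
  show "pairs \<subseteq> Pow (carrier G) \<times> dual G"
    using subgroup.mem_carrier by (fastforce simp: pairs_iff)
  show "finite (Pow (carrier G) \<times> dual G)"
    using finite_carrier finite_dual by simp
qed

lemma theta_pair: "subgroup K G \<Longrightarrow> (K, theta_char) \<in> pairs"
  using subgroup.subset theta_char_dual by (fastforce simp: pairs_iff)

section \<open>Points of a weighted permutation action and their types\<close>

abbreviation wpa :: "('a, 'x) wpa \<Rightarrow> bool" where
  "wpa \<equiv> is_wpa G \<theta>"

text \<open>Bijectivity need not be supplied: the map of \<open>inv \<alpha>\<close> inverts that of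
  \<open>\<alpha>\<close>.\<close>

lemma group_actionI:
  assumes closed: "\<And>\<alpha> p. \<lbrakk>\<alpha> \<in> carrier G; p \<in> S\<rbrakk> \<Longrightarrow> f \<alpha> p \<in> S"
    and ext: "\<And>\<alpha>. \<alpha> \<in> carrier G \<Longrightarrow> f \<alpha> \<in> extensional S"
    and one: "\<And>p. p \<in> S \<Longrightarrow> f \<one> p = p"
    and mult: "\<And>\<alpha> \<beta> p. \<lbrakk>\<alpha> \<in> carrier G; \<beta> \<in> carrier G; p \<in> S\<rbrakk> \<Longrightarrow> f (\<alpha> \<otimes> \<beta>) p = f \<alpha> (f \<beta> p)"
  shows "group_action G S f"
proof -
  have Bij: "f \<alpha> \<in> Bij S" if \<alpha>: "\<alpha> \<in> carrier G" for \<alpha>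
  proof -
    have "bij_betw (f \<alpha>) S S"
      by (rule bij_betw_byWitness[of _ "f (inv \<alpha>)"])
         (use \<alpha> closed one mult[symmetric] in auto)
    then show ?thesis using ext[OF \<alpha>] by (simp add: Bij_def)
  qed
  have "f (\<alpha> \<otimes> \<beta>) = compose S (f \<alpha>) (f \<beta>)" if "\<alpha> \<in> carrier G" "\<beta> \<in> carrier G" for \<alpha> \<beta>
    using that mult by (intro extensionalityI[OF ext]) (auto simp: compose_def)
  then have "f \<in> hom G (BijGroup S)"
    using Bij by (auto simp: hom_def BijGroup_def)
  then show ?thesis
    by (simp add: group_action_def group_hom_def group_hom_axioms_def group_BijGroup is_group)
qed

text \<open>The weight condition may be checked without denominators, because the quotient of
  \<theta> values equals 1 by \<open>theta_mult\<close>.\<close>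

lemma wpaI:
  assumes "finite (support \<Phi>)"
    and "\<And>\<alpha> p. \<lbrakk>\<alpha> \<in> carrier G; p \<in> support \<Phi>\<rbrakk> \<Longrightarrow> action \<Phi> \<alpha> p \<in> support \<Phi>"
    and "\<And>\<alpha>. \<alpha> \<in> carrier G \<Longrightarrow> action \<Phi> \<alpha> \<in> extensional (support \<Phi>)"
    and "\<And>p. p \<in> support \<Phi> \<Longrightarrow> action \<Phi> \<one> p = p"
    and "\<And>\<alpha> \<beta> p. \<lbrakk>\<alpha> \<in> carrier G; \<beta> \<in> carrier G; p \<in> support \<Phi>\<rbrakk>
           \<Longrightarrow> action \<Phi> (\<alpha> \<otimes> \<beta>) p = action \<Phi> \<alpha> (action \<Phi> \<beta> p)"
    and nz: "\<And>p. p \<in> support \<Phi> \<Longrightarrow> weight \<Phi> p \<noteq> 0"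
    and w: "\<And>\<alpha> \<beta> p. \<lbrakk>\<alpha> \<in> carrier G; \<beta> \<in> carrier G; p \<in> support \<Phi>\<rbrakk>
           \<Longrightarrow> weight \<Phi> (action \<Phi> \<alpha> p) * weight \<Phi> (action \<Phi> \<beta> p)
               = weight \<Phi> p * weight \<Phi> (action \<Phi> (\<alpha> \<otimes> \<beta>) p)"
  shows "wpa \<Phi>"
proof -
  have "weight \<Phi> (action \<Phi> \<alpha> p) * weight \<Phi> (action \<Phi> \<beta> p)
          / (weight \<Phi> p * weight \<Phi> (action \<Phi> (\<alpha> \<otimes> \<beta>) p)) = \<theta> \<alpha> * \<theta> \<beta> / \<theta> (\<alpha> \<otimes> \<beta>)"
    if "\<alpha> \<in> carrier G" "\<beta> \<in> carrier G" "p \<in> support \<Phi>" for \<alpha> \<beta> p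
    unfolding w[OF that] using that assms(2) nz theta_nonzero by (simp add: theta_mult)
  moreover have "group_action G (support \<Phi>) (action \<Phi>)"
    using assms(2-5) by (rule group_actionI)
  ultimately show ?thesis
    unfolding is_wpa_def using assms(1) nz by blast
qed

context
  fixes \<Phi> :: "('a, 'x) wpa"
  assumes wpa: "wpa \<Phi>"
begin

lemma wpa_finite: "finite (support \<Phi>)"
  using wpa by (simp add: is_wpa_def)

lemma wpa_group_action: "group_action G (support \<Phi>) (action \<Phi>)"
  using wpa by (simp add: is_wpa_def)

lemma wpa_closed: "\<lbrakk>\<alpha> \<in> carrier G; p \<in> support \<Phi>\<rbrakk> \<Longrightarrow> action \<Phi> \<alpha> p \<in> support \<Phi>"
  using group_action.element_image[OF wpa_group_action] by blast

lemma wpa_one: "p \<in> support \<Phi> \<Longrightarrow> action \<Phi> \<one> p = p"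
  using group_action.id_eq_one[OF wpa_group_action] by (metis restrict_apply')

lemma wpa_act_mult:
  "\<lbrakk>\<alpha> \<in> carrier G; \<beta> \<in> carrier G; p \<in> support \<Phi>\<rbrakk>
    \<Longrightarrow> action \<Phi> (\<alpha> \<otimes> \<beta>) p = action \<Phi> \<alpha> (action \<Phi> \<beta> p)"
  using group_action.composition_rule[OF wpa_group_action] by blast

lemma wpa_inv_act:
  "\<lbrakk>\<alpha> \<in> carrier G; p \<in> support \<Phi>\<rbrakk> \<Longrightarrow> action \<Phi> (inv \<alpha>) (action \<Phi> \<alpha> p) = p"
  by (metis wpa_act_mult inv_closed l_inv wpa_one)

lemma wpa_act_inv:
  "\<lbrakk>\<alpha> \<in> carrier G; p \<in> support \<Phi>\<rbrakk> \<Longrightarrow> action \<Phi> \<alpha> (action \<Phi> (inv \<alpha>) p) = p"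
  by (metis wpa_act_mult inv_closed r_inv wpa_one)

lemma wpa_act_commute:
  "\<lbrakk>\<alpha> \<in> carrier G; \<beta> \<in> carrier G; p \<in> support \<Phi>\<rbrakk>
    \<Longrightarrow> action \<Phi> \<alpha> (action \<Phi> \<beta> p) = action \<Phi> \<beta> (action \<Phi> \<alpha> p)"
  by (metis wpa_act_mult m_comm)

lemma wpa_weight_nonzero: "p \<in> support \<Phi> \<Longrightarrow> weight \<Phi> p \<noteq> 0"
  using wpa by (simp add: is_wpa_def)

lemma wpa_weight:
  assumes "\<alpha> \<in> carrier G" "\<beta> \<in> carrier G" "p \<in> support \<Phi>"
  shows "weight \<Phi> (action \<Phi> \<alpha> p) * weight \<Phi> (action \<Phi> \<beta> p)
         = weight \<Phi> p * weight \<Phi> (action \<Phi> (\<alpha> \<otimes> \<beta>) p)"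
proof -
  have "\<theta> \<alpha> * \<theta> \<beta> / \<theta> (\<alpha> \<otimes> \<beta>) = 1"
    using assms theta_nonzero by (simp add: theta_mult)
  then have "weight \<Phi> (action \<Phi> \<alpha> p) * weight \<Phi> (action \<Phi> \<beta> p)
          / (weight \<Phi> p * weight \<Phi> (action \<Phi> (\<alpha> \<otimes> \<beta>) p)) = 1"
    using assms wpa by (simp add: is_wpa_def)
  then show ?thesis by simp
qed

lemma subgroup_stabilizer: "p \<in> support \<Phi> \<Longrightarrow> subgroup (stabilizer G (action \<Phi>) p) G"
  using group_action.stabilizer_subgroup[OF wpa_group_action] .

end

text \<open>A point of \<open>\<W>[H,\<xi>]\<close> has type \<open>(H,\<xi>)\<close>.\<close>

definition point_char :: "('a, 'x) wpa \<Rightarrow> 'x \<Rightarrow> 'a \<Rightarrow> complex" where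
  "point_char \<Phi> p = (\<lambda>\<alpha>\<in>carrier G. \<theta> \<alpha> * (weight \<Phi> p / weight \<Phi> (action \<Phi> \<alpha> p)))"

definition point_type :: "('a, 'x) wpa \<Rightarrow> 'x \<Rightarrow> 'a set \<times> ('a \<Rightarrow> complex)" where
  "point_type \<Phi> p = (stabilizer G (action \<Phi>) p, point_char \<Phi> p)"

definition type_count :: "('a, 'x) wpa \<Rightarrow> 'a set \<times> ('a \<Rightarrow> complex) \<Rightarrow> nat" where
  "type_count \<Phi> \<tau> = card {p \<in> support \<Phi>. point_type \<Phi> p = \<tau>}"

text \<open>The weight condition is exactly multiplicativity of \<open>point_char\<close>. On the
  stabiliser the weight quotient is 1, which leaves \<theta>.\<close>

lemma point_type_pairs:
  assumes \<Phi>: "wpa \<Phi>" and p: "p \<in> support \<Phi>"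
  shows "point_type \<Phi> p \<in> pairs"
proof -
  note nz = wpa_weight_nonzero[OF \<Phi>] wpa_closed[OF \<Phi>] theta_nonzero
  have "point_char \<Phi> p (\<alpha> \<otimes> \<beta>) = point_char \<Phi> p \<alpha> * point_char \<Phi> p \<beta>"
    if "\<alpha> \<in> carrier G" "\<beta> \<in> carrier G" for \<alpha> \<beta>
    using that p nz wpa_weight[OF \<Phi> that p] unfolding point_char_def
    by (simp add: theta_mult frac_eq_eq)
  then have "point_char \<Phi> p \<in> dual G"
    using p nz by (auto simp: dual_iff) (auto simp: point_char_def)
  moreover have "point_char \<Phi> p \<alpha> = \<theta> \<alpha>" if "\<alpha> \<in> stabilizer G (action \<Phi>) p" for \<alpha>
    using that p nz by (auto simp: point_char_def stabilizer_def)
  ultimately show ?thesis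
    using subgroup_stabilizer[OF \<Phi> p] by (auto simp: point_type_def pairs_iff)
qed

text \<open>In a commutative group stabilisers do not change along an orbit, and the weight
  condition says the same of the weight quotients. A type thus belongs to a whole orbit.\<close>

lemma point_type_act:
  assumes \<Phi>: "wpa \<Phi>" and p: "p \<in> support \<Phi>" and \<alpha>: "\<alpha> \<in> carrier G"
  shows "point_type \<Phi> (action \<Phi> \<alpha> p) = point_type \<Phi> p"
proof -
  note nz = wpa_weight_nonzero[OF \<Phi>] wpa_closed[OF \<Phi>]
  have "action \<Phi> \<beta> (action \<Phi> \<alpha> p) = action \<Phi> \<alpha> p \<longleftrightarrow> action \<Phi> \<beta> p = p"
    if "\<beta> \<in> carrier G" for \<beta>
    by (metis \<Phi> \<alpha> p that wpa_act_commute wpa_closed wpa_inv_act)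
  then have "stabilizer G (action \<Phi>) (action \<Phi> \<alpha> p) = stabilizer G (action \<Phi>) p"
    by (auto simp: stabilizer_def)
  moreover have "weight \<Phi> (action \<Phi> \<alpha> p) / weight \<Phi> (action \<Phi> \<beta> (action \<Phi> \<alpha> p))
      = weight \<Phi> p / weight \<Phi> (action \<Phi> \<beta> p)" if "\<beta> \<in> carrier G" for \<beta>
    using that p \<alpha> nz wpa_weight[OF \<Phi> that \<alpha> p]
    by (simp add: frac_eq_eq wpa_act_mult[OF \<Phi>, symmetric] mult.commute)
  then have "point_char \<Phi> (action \<Phi> \<alpha> p) = point_char \<Phi> p"
    unfolding point_char_def by (intro restrict_ext) simp
  ultimately show ?thesis
    by (simp add: point_type_def)
qed

text \<open>Points are grouped by type. The codomain is a general semiring because the lemma serves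
  both complex sums (Upsilon) and natural ones (fixed points, degrees).\<close>

lemma sum_point_types:
  fixes f :: "'a set \<times> ('a \<Rightarrow> complex) \<Rightarrow> 'b :: comm_semiring_1"
  assumes \<Phi>: "wpa \<Phi>"
  shows "(\<Sum>p\<in>support \<Phi>. f (point_type \<Phi> p)) = (\<Sum>\<tau>\<in>pairs. of_nat (type_count \<Phi> \<tau>) * f \<tau>)"
proof -
  have "(\<Sum>p\<in>support \<Phi>. f (point_type \<Phi> p)) =
        (\<Sum>\<tau>\<in>pairs. \<Sum>p\<in>{p \<in> support \<Phi>. point_type \<Phi> p = \<tau>}. f (point_type \<Phi> p))"
    using wpa_finite[OF \<Phi>] finite_pairs point_type_pairs[OF \<Phi>]
    by (intro sum.group[symmetric]) auto
  then show ?thesis by (simp add: type_count_def)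
qed

text \<open>A point fixed by \<open>\<alpha>\<close> contributes precisely the value of its
  character at \<open>\<beta>\<close>, and being fixed by \<open>\<alpha>\<close> is visible in the
  first component of its type.\<close>

lemma Upsilon_eq_sum_types:
  assumes \<Phi>: "wpa \<Phi>" and "\<alpha> \<in> carrier G" "\<beta> \<in> carrier G"
  shows "Upsilon \<theta> \<Phi> \<alpha> \<beta> =
    (\<Sum>\<tau>\<in>pairs. of_nat (type_count \<Phi> \<tau>) * (if \<alpha> \<in> fst \<tau> then snd \<tau> \<beta> else 0))"
proof -
  have "Upsilon \<theta> \<Phi> \<alpha> \<beta> = (\<Sum>p\<in>Fix \<Phi> \<alpha>. point_char \<Phi> p \<beta>)"
    using assms by (simp add: Upsilon_def point_char_def sum_distrib_left)
  also have "\<dots> = (\<Sum>p\<in>support \<Phi>. if action \<Phi> \<alpha> p = p then point_char \<Phi> p \<beta> else 0)"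
    using wpa_finite[OF \<Phi>]
    by (simp add: Fix_def invariants_def sum.inter_filter)
  also have "\<dots> = (\<Sum>p\<in>support \<Phi>. if \<alpha> \<in> fst (point_type \<Phi> p) then snd (point_type \<Phi> p) \<beta> else 0)"
    using assms by (intro sum.cong) (auto simp: point_type_def stabilizer_def)
  finally show ?thesis
    using sum_point_types[OF \<Phi>, of "\<lambda>\<tau>. if \<alpha> \<in> fst \<tau> then snd \<tau> \<beta> else 0"] by simp
qed

lemma card_Fix_eq_sum_types:
  assumes \<Phi>: "wpa \<Phi>" and "\<alpha> \<in> carrier G" "\<beta> \<in> carrier G"
  shows "card (Fix \<Phi> \<alpha> \<inter> Fix \<Phi> \<beta>) =
    (\<Sum>\<tau>\<in>pairs. type_count \<Phi> \<tau> * (if \<alpha> \<in> fst \<tau> \<and> \<beta> \<in> fst \<tau> then 1 else 0))"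
proof -
  have "Fix \<Phi> \<alpha> \<inter> Fix \<Phi> \<beta> =
      {p \<in> support \<Phi>. \<alpha> \<in> fst (point_type \<Phi> p) \<and> \<beta> \<in> fst (point_type \<Phi> p)}"
    using assms by (auto simp: Fix_def invariants_def point_type_def stabilizer_def)
  then have "card (Fix \<Phi> \<alpha> \<inter> Fix \<Phi> \<beta>) = (\<Sum>p\<in>support \<Phi>.
      if \<alpha> \<in> fst (point_type \<Phi> p) \<and> \<beta> \<in> fst (point_type \<Phi> p) then 1 else 0)"
    using wpa_finite[OF \<Phi>] by (simp flip: sum.inter_filter)
  also have "\<dots> = (\<Sum>\<tau>\<in>pairs. of_nat (type_count \<Phi> \<tau>) *
      (if \<alpha> \<in> fst \<tau> \<and> \<beta> \<in> fst \<tau> then 1 else 0))"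
    using sum_point_types[OF \<Phi>, of "\<lambda>\<tau>. if \<alpha> \<in> fst \<tau> \<and> \<beta> \<in> fst \<tau> then 1 else (0::nat)"]
    by simp
  finally show ?thesis by simp
qed

subsection \<open>Equivalence means equal numbers of points of each type\<close>

text \<open>Only quotients of weights within one orbit enter the type, so a factor that is constant
  on orbits cancels.\<close>

lemma wpa_equiv_point_type:
  assumes \<Phi>: "wpa \<Phi>" and \<Psi>: "wpa \<Psi>" and f: "bij_betw f (support \<Phi>) (support \<Psi>)"
    and equivariant: "\<And>\<alpha> p. \<lbrakk>\<alpha> \<in> carrier G; p \<in> support \<Phi>\<rbrakk> \<Longrightarrow> f (action \<Phi> \<alpha> p) = action \<Psi> \<alpha> (f p)"
    and ratio: "\<And>Orb. Orb \<in> orbits G (support \<Phi>) (action \<Phi>)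
                  \<Longrightarrow> \<exists>c. \<forall>p\<in>Orb. weight \<Psi> (f p) / weight \<Phi> p = c"
    and p: "p \<in> support \<Phi>"
  shows "point_type \<Psi> (f p) = point_type \<Phi> p"
proof -
  have fp: "f p \<in> support \<Psi>"
    using f p bij_betwE by blast
  have "action \<Psi> \<alpha> (f p) = f p \<longleftrightarrow> action \<Phi> \<alpha> p = p" if "\<alpha> \<in> carrier G" for \<alpha>
    using f p that wpa_closed[OF \<Phi> that p] unfolding equivariant[OF that p, symmetric]
    by (auto simp: bij_betw_def inj_on_eq_iff)
  then have "stabilizer G (action \<Psi>) (f p) = stabilizer G (action \<Phi>) p"
    by (auto simp: stabilizer_def)
  moreover have "weight \<Psi> (f p) / weight \<Psi> (action \<Psi> \<alpha> (f p)) =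
      weight \<Phi> p / weight \<Phi> (action \<Phi> \<alpha> p)" if \<alpha>: "\<alpha> \<in> carrier G" for \<alpha>
  proof -
    have "orbit G (action \<Phi>) p \<in> orbits G (support \<Phi>) (action \<Phi>)"
      using p by (auto simp: orbits_def)
    moreover have "p \<in> orbit G (action \<Phi>) p"
      unfolding orbit_def using wpa_one[OF \<Phi> p] by force
    moreover have "action \<Phi> \<alpha> p \<in> orbit G (action \<Phi>) p"
      using \<alpha> by (auto simp: orbit_def)
    ultimately have "weight \<Psi> (f (action \<Phi> \<alpha> p)) / weight \<Phi> (action \<Phi> \<alpha> p) = weight \<Psi> (f p) / weight \<Phi> p"
      using ratio by metis
    then show ?thesis
      using wpa_weight_nonzero[OF \<Phi>] wpa_weight_nonzero[OF \<Psi>] wpa_closed[OF \<Phi> \<alpha> p]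
        wpa_closed[OF \<Psi> \<alpha> fp] p fp
      by (simp add: equivariant[OF \<alpha> p] frac_eq_eq mult.commute)
  qed
  then have "point_char \<Psi> (f p) = point_char \<Phi> p"
    unfolding point_char_def by (intro restrict_ext) simp
  ultimately show ?thesis by (simp add: point_type_def)
qed

text \<open>Converse of the preceding cancellation: equal characters at p make the ratio of the two
  weights at any point of the orbit equal to the ratio at p.\<close>

lemma wpa_equivI:
  assumes \<Phi>: "wpa \<Phi>" and \<Psi>: "wpa \<Psi>" and f: "bij_betw f (support \<Phi>) (support \<Psi>)"
    and equivariant: "\<And>\<alpha> p. \<lbrakk>\<alpha> \<in> carrier G; p \<in> support \<Phi>\<rbrakk> \<Longrightarrow> f (action \<Phi> \<alpha> p) = action \<Psi> \<alpha> (f p)"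
    and type: "\<And>p. p \<in> support \<Phi> \<Longrightarrow> point_type \<Psi> (f p) = point_type \<Phi> p"
  shows "wpa_equiv G \<Phi> \<Psi>"
proof -
  have "\<exists>c. \<forall>q\<in>Orb. weight \<Psi> (f q) / weight \<Phi> q = c"
    if "Orb \<in> orbits G (support \<Phi>) (action \<Phi>)" for Orb
  proof -
    obtain p where p: "p \<in> support \<Phi>" and Orb: "Orb = orbit G (action \<Phi>) p"
      using \<open>Orb \<in> _\<close> by (auto simp: orbits_def)
    have fp: "f p \<in> support \<Psi>"
      using f p bij_betwE by blast
    have "weight \<Psi> (f (action \<Phi> \<alpha> p)) / weight \<Phi> (action \<Phi> \<alpha> p) = weight \<Psi> (f p) / weight \<Phi> p"
      if \<alpha>: "\<alpha> \<in> carrier G" for \<alpha>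
    proof -
      have "point_char \<Psi> (f p) \<alpha> = point_char \<Phi> p \<alpha>"
        using type[OF p] by (simp add: point_type_def)
      then show ?thesis
        using \<alpha> theta_nonzero[OF \<alpha>] wpa_weight_nonzero[OF \<Phi>] wpa_weight_nonzero[OF \<Psi>]
          wpa_closed[OF \<Phi> \<alpha> p] wpa_closed[OF \<Psi> \<alpha> fp] p fp
        by (simp add: point_char_def equivariant[OF \<alpha> p] frac_eq_eq mult.commute)
    qed
    then show ?thesis unfolding Orb orbit_def by blast
  qed
  then show ?thesis
    unfolding wpa_equiv_def using f equivariant by blast
qed

text \<open>Built orbit by orbit: points of equal type have isomorphic orbits, and deleting both orbits
  keeps the numbers of points of each type equal.\<close>

lemma ex_type_preserving_bij:
  fixes \<Phi> :: "('a, 'x) wpa" and \<Psi> :: "('a, 'y) wpa"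
  assumes \<Phi>: "wpa \<Phi>" and \<Psi>: "wpa \<Psi>"
    and "A \<subseteq> support \<Phi>" "B \<subseteq> support \<Psi>"
    and "\<And>\<alpha> p. \<lbrakk>\<alpha> \<in> carrier G; p \<in> A\<rbrakk> \<Longrightarrow> action \<Phi> \<alpha> p \<in> A"
    and "\<And>\<alpha> q. \<lbrakk>\<alpha> \<in> carrier G; q \<in> B\<rbrakk> \<Longrightarrow> action \<Psi> \<alpha> q \<in> B"
    and "\<And>\<tau>. card {p \<in> A. point_type \<Phi> p = \<tau>} = card {q \<in> B. point_type \<Psi> q = \<tau>}"
  shows "\<exists>f. bij_betw f A B \<and>
           (\<forall>p\<in>A. point_type \<Psi> (f p) = point_type \<Phi> p \<and>
                   (\<forall>\<alpha>\<in>carrier G. f (action \<Phi> \<alpha> p) = action \<Psi> \<alpha> (f p)))"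
  using assms(3-)
proof (induction "card A" arbitrary: A B rule: less_induct)
  case less
  note AB = less.prems(1,2) and closedA = less.prems(3) and closedB = less.prems(4)
    and counts = less.prems(5)
  have finA: "finite A" and finB: "finite B"
    using AB wpa_finite[OF \<Phi>] wpa_finite[OF \<Psi>] finite_subset by blast+
  show ?case
  proof (cases "A = {}")
    case True
    have "B = {}"
    proof (rule ccontr)
      assume "B \<noteq> {}"
      then obtain q where "q \<in> B" by blast
      then have "0 < card {r \<in> B. point_type \<Psi> r = point_type \<Psi> q}"
        using finB by (auto simp: card_gt_0_iff)
      with counts[of "point_type \<Psi> q"] True show False by simp
    qed
    then show ?thesis using True by (simp add: bij_betw_def)
  next
    case False
    then obtain p where p: "p \<in> A" by blast
    then have "0 < card {r \<in> A. point_type \<Phi> r = point_type \<Phi> p}"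
      using finA by (auto simp: card_gt_0_iff)
    then have "{q \<in> B. point_type \<Psi> q = point_type \<Phi> p} \<noteq> {}"
      unfolding counts by (auto simp: card_gt_0_iff)
    then obtain q where q: "q \<in> B" and type: "point_type \<Psi> q = point_type \<Phi> p" by blast
    have p': "p \<in> support \<Phi>" and q': "q \<in> support \<Psi>" using p q AB by auto
    \<comment> \<open>Each side says that \<open>inv \<beta> \<otimes> \<alpha>\<close> fixes the
      base point, and equal types have equal stabilisers.\<close>
    have act_eq: "action \<Phi> \<alpha> p = action \<Phi> \<beta> p \<longleftrightarrow> action \<Psi> \<alpha> q = action \<Psi> \<beta> q"
      if "\<alpha> \<in> carrier G" "\<beta> \<in> carrier G" for \<alpha> \<beta>
    proof -
      have "action \<Phi> \<alpha> p = action \<Phi> \<beta> p \<longleftrightarrow> action \<Phi> (inv \<beta> \<otimes> \<alpha>) p = p"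
        using that p' wpa_act_mult[OF \<Phi>] wpa_inv_act[OF \<Phi>] wpa_act_inv[OF \<Phi>] by (metis inv_closed wpa_closed[OF \<Phi>])
      also have "\<dots> \<longleftrightarrow> inv \<beta> \<otimes> \<alpha> \<in> stabilizer G (action \<Phi>) p"
        using that by (simp add: stabilizer_def)
      also have "\<dots> \<longleftrightarrow> inv \<beta> \<otimes> \<alpha> \<in> stabilizer G (action \<Psi>) q"
        using type by (simp add: point_type_def)
      also have "\<dots> \<longleftrightarrow> action \<Psi> (inv \<beta> \<otimes> \<alpha>) q = q"
        using that by (simp add: stabilizer_def)
      also have "\<dots> \<longleftrightarrow> action \<Psi> \<alpha> q = action \<Psi> \<beta> q"
        using that q' wpa_act_mult[OF \<Psi>] wpa_inv_act[OF \<Psi>] wpa_act_inv[OF \<Psi>] by (metis inv_closed wpa_closed[OF \<Psi>])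
      finally show ?thesis .
    qed
    define P where "P = (\<lambda>\<alpha>. action \<Phi> \<alpha> p) ` carrier G"
    define Q where "Q = (\<lambda>\<alpha>. action \<Psi> \<alpha> q) ` carrier G"
    have "P \<subseteq> A" "Q \<subseteq> B"
      using p q closedA closedB by (auto simp: P_def Q_def)
    have pP: "p \<in> P"
      using wpa_one[OF \<Phi> p'] by (force simp: P_def)
    \<comment> \<open>The map sends \<open>action \<Phi> \<alpha> p\<close> to
      \<open>action \<Psi> \<alpha> q\<close>; by \<open>act_eq\<close> it does not matter which
      \<open>\<alpha>\<close> is chosen.\<close>
    define h where "h x = action \<Psi> (SOME \<alpha>. \<alpha> \<in> carrier G \<and> action \<Phi> \<alpha> p = x) q" for x
    have h: "h (action \<Phi> \<alpha> p) = action \<Psi> \<alpha> q" if "\<alpha> \<in> carrier G" for \<alpha>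
    proof -
      define \<beta> where "\<beta> = (SOME \<beta>. \<beta> \<in> carrier G \<and> action \<Phi> \<beta> p = action \<Phi> \<alpha> p)"
      have "\<beta> \<in> carrier G \<and> action \<Phi> \<beta> p = action \<Phi> \<alpha> p"
        unfolding \<beta>_def by (rule someI[of _ \<alpha>]) (use that in simp)
      then show ?thesis
        using act_eq[of \<beta> \<alpha>] that by (simp add: h_def flip: \<beta>_def)
    qed
    have bij_h: "bij_betw h P Q"
      unfolding bij_betw_def
    proof
      show "inj_on h P"
        by (rule inj_onI) (auto simp: P_def h act_eq)
      show "h ` P = Q"
        by (force simp: P_def Q_def h image_image)
    qed
    have type_P: "point_type \<Phi> x = point_type \<Phi> p" if "x \<in> P" for x
      using that p' point_type_act[OF \<Phi>] by (auto simp: P_def)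
    have type_Q: "point_type \<Psi> y = point_type \<Phi> p" if "y \<in> Q" for y
      using that q' type point_type_act[OF \<Psi>] by (auto simp: Q_def)
    \<comment> \<open>The complement of the orbit is stable as well, as the induction hypothesis
      requires of \<open>A - P\<close>.\<close>
    have act_P: "action \<Phi> \<alpha> x \<in> P \<longleftrightarrow> x \<in> P" if "\<alpha> \<in> carrier G" "x \<in> A" for \<alpha> x
    proof
      show "action \<Phi> \<alpha> x \<in> P" if "x \<in> P"
        using that \<open>\<alpha> \<in> _\<close> p' wpa_act_mult[OF \<Phi>, symmetric] by (auto simp: P_def)
      assume "action \<Phi> \<alpha> x \<in> P"
      then obtain \<beta> where "\<beta> \<in> carrier G" "action \<Phi> \<alpha> x = action \<Phi> \<beta> p"
        by (auto simp: P_def)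
      then have "x = action \<Phi> (inv \<alpha> \<otimes> \<beta>) p"
        using that p' AB by (metis inv_closed subsetD wpa_act_mult[OF \<Phi>] wpa_inv_act[OF \<Phi>])
      then show "x \<in> P"
        using that \<open>\<beta> \<in> _\<close> by (auto simp: P_def)
    qed
    have act_Q: "action \<Psi> \<alpha> y \<in> Q \<longleftrightarrow> y \<in> Q" if "\<alpha> \<in> carrier G" "y \<in> B" for \<alpha> y
    proof
      show "action \<Psi> \<alpha> y \<in> Q" if "y \<in> Q"
        using that \<open>\<alpha> \<in> _\<close> q' wpa_act_mult[OF \<Psi>, symmetric] by (auto simp: Q_def)
      assume "action \<Psi> \<alpha> y \<in> Q"
      then obtain \<beta> where "\<beta> \<in> carrier G" "action \<Psi> \<alpha> y = action \<Psi> \<beta> q"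
        by (auto simp: Q_def)
      then have "y = action \<Psi> (inv \<alpha> \<otimes> \<beta>) q"
        using that q' AB by (metis inv_closed subsetD wpa_act_mult[OF \<Psi>] wpa_inv_act[OF \<Psi>])
      then show "y \<in> Q"
        using that \<open>\<beta> \<in> _\<close> by (auto simp: Q_def)
    qed
    \<comment> \<open>The two orbits have the same size and consist of points of one common type, so
      a single count drops, by the same amount on both sides.\<close>
    have counts': "card {x \<in> A - P. point_type \<Phi> x = \<tau>} = card {y \<in> B - Q. point_type \<Psi> y = \<tau>}" for \<tau>
    proof (cases "\<tau> = point_type \<Phi> p")
      case True
      have "{x \<in> A - P. point_type \<Phi> x = \<tau>} = {x \<in> A. point_type \<Phi> x = \<tau>} - P"
        "{y \<in> B - Q. point_type \<Psi> y = \<tau>} = {y \<in> B. point_type \<Psi> y = \<tau>} - Q" by auto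
      moreover have "P \<subseteq> {x \<in> A. point_type \<Phi> x = \<tau>}" "Q \<subseteq> {y \<in> B. point_type \<Psi> y = \<tau>}"
        using type_P type_Q True \<open>P \<subseteq> A\<close> \<open>Q \<subseteq> B\<close> by auto
      moreover have "card P = card Q" using bij_h by (rule bij_betw_same_card)
      moreover have "finite P" "finite Q"
        using \<open>P \<subseteq> A\<close> \<open>Q \<subseteq> B\<close> finA finB finite_subset by blast+
      ultimately show ?thesis using counts[of \<tau>] by (simp add: card_Diff_subset)
    next
      case False
      have "{x \<in> A - P. point_type \<Phi> x = \<tau>} = {x \<in> A. point_type \<Phi> x = \<tau>}"
        "{y \<in> B - Q. point_type \<Psi> y = \<tau>} = {y \<in> B. point_type \<Psi> y = \<tau>}"
        using False type_P type_Q by auto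
      then show ?thesis using counts[of \<tau>] by simp
    qed
    have "\<exists>f. bij_betw f (A - P) (B - Q) \<and>
           (\<forall>x\<in>A - P. point_type \<Psi> (f x) = point_type \<Phi> x \<and>
                   (\<forall>\<alpha>\<in>carrier G. f (action \<Phi> \<alpha> x) = action \<Psi> \<alpha> (f x)))"
    proof (rule less.hyps)
      show "card (A - P) < card A"
        using finA p pP by (intro psubset_card_mono) auto
      show "A - P \<subseteq> support \<Phi>" "B - Q \<subseteq> support \<Psi>"
        using AB by auto
          show "card {x \<in> A - P. point_type \<Phi> x = \<tau>} = card {y \<in> B - Q. point_type \<Psi> y = \<tau>}" for \<tau>
        by (rule counts')
    qed (simp_all add: act_P act_Q closedA closedB)
    then obtain f where bij_f: "bij_betw f (A - P) (B - Q)"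
      and f: "\<And>x. x \<in> A - P \<Longrightarrow> point_type \<Psi> (f x) = point_type \<Phi> x"
        "\<And>\<alpha> x. \<lbrakk>\<alpha> \<in> carrier G; x \<in> A - P\<rbrakk> \<Longrightarrow> f (action \<Phi> \<alpha> x) = action \<Psi> \<alpha> (f x)"
      by auto
    define g where "g x = (if x \<in> P then h x else f x)" for x
    have "bij_betw g (P \<union> (A - P)) (Q \<union> (B - Q))"
    proof (rule bij_betw_combine)
      show "bij_betw g P Q" using bij_h by (simp add: g_def cong: bij_betw_cong)
      have "bij_betw g (A - P) (B - Q) \<longleftrightarrow> bij_betw f (A - P) (B - Q)"
        by (intro bij_betw_cong) (simp add: g_def)
      then show "bij_betw g (A - P) (B - Q)" using bij_f by simp
    qed simp
    moreover have "P \<union> (A - P) = A" "Q \<union> (B - Q) = B"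
      using \<open>P \<subseteq> A\<close> \<open>Q \<subseteq> B\<close> by auto
    ultimately have "bij_betw g A B" by simp
    moreover have "point_type \<Psi> (g x) = point_type \<Phi> x" if "x \<in> A" for x
    proof (cases "x \<in> P")
      case True
      then have "h x \<in> Q" using bij_h bij_betwE by blast
      then show ?thesis using True type_P type_Q by (simp add: g_def)
    qed (use f that in \<open>simp add: g_def\<close>)
    moreover have "g (action \<Phi> \<alpha> x) = action \<Psi> \<alpha> (g x)" if "x \<in> A" "\<alpha> \<in> carrier G" for \<alpha> x
    proof (cases "x \<in> P")
      case True
      then obtain \<beta> where \<beta>: "\<beta> \<in> carrier G" "x = action \<Phi> \<beta> p" by (auto simp: P_def)
      then have "h (action \<Phi> \<alpha> x) = action \<Psi> \<alpha> (h x)"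
        using that p' q' h[of "\<alpha> \<otimes> \<beta>"] h[of \<beta>]
        by (simp add: wpa_act_mult[OF \<Phi>] wpa_act_mult[OF \<Psi>])
      then show ?thesis using True act_P[of \<alpha> x] that by (simp add: g_def)
    qed (use f that act_P in \<open>simp add: g_def\<close>)
    ultimately show ?thesis by blast
  qed
qed

lemma type_count_outside: "\<lbrakk>wpa \<Phi>; \<tau> \<notin> pairs\<rbrakk> \<Longrightarrow> type_count \<Phi> \<tau> = 0"
  using point_type_pairs[of \<Phi>] by (auto simp: type_count_def card_eq_0_iff)

text \<open>This turns equivalence, also between actions on different types of points, into equality
  of finitely many numbers; the classification is carried out on these numbers.\<close>

lemma wpa_equiv_iff_type_count:
  assumes \<Phi>: "wpa \<Phi>" and \<Psi>: "wpa \<Psi>"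
  shows "wpa_equiv G \<Phi> \<Psi> \<longleftrightarrow> (\<forall>\<tau>\<in>pairs. type_count \<Phi> \<tau> = type_count \<Psi> \<tau>)"
proof
  assume "wpa_equiv G \<Phi> \<Psi>"
  then obtain f where f: "bij_betw f (support \<Phi>) (support \<Psi>)"
    and type: "\<And>p. p \<in> support \<Phi> \<Longrightarrow> point_type \<Psi> (f p) = point_type \<Phi> p"
    unfolding wpa_equiv_def using wpa_equiv_point_type[OF assms] by metis
  have "type_count \<Phi> \<tau> = type_count \<Psi> \<tau>" for \<tau>
    unfolding type_count_def
  proof (rule bij_betw_same_card[of f], rule bij_betw_subset[OF f])
    show "f ` {p \<in> support \<Phi>. point_type \<Phi> p = \<tau>} = {p \<in> support \<Psi>. point_type \<Psi> p = \<tau>}"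
      using f type by (fastforce simp: bij_betw_def)
  qed auto
  then show "\<forall>\<tau>\<in>pairs. type_count \<Phi> \<tau> = type_count \<Psi> \<tau>" by blast
next
  assume "\<forall>\<tau>\<in>pairs. type_count \<Phi> \<tau> = type_count \<Psi> \<tau>"
  then have "type_count \<Phi> \<tau> = type_count \<Psi> \<tau>" for \<tau>
    using type_count_outside[OF \<Phi>] type_count_outside[OF \<Psi>] by metis
  then obtain f where "bij_betw f (support \<Phi>) (support \<Psi>)"
    "\<And>p. p \<in> support \<Phi> \<Longrightarrow> point_type \<Psi> (f p) = point_type \<Phi> p \<and>
       (\<forall>\<alpha>\<in>carrier G. f (action \<Phi> \<alpha> p) = action \<Psi> \<alpha> (f p))"
    using ex_type_preserving_bij[OF assms order.refl order.refl] wpa_closed[OF \<Phi>] wpa_closed[OF \<Psi>]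
    unfolding type_count_def by blast
  then show "wpa_equiv G \<Phi> \<Psi>"
    using wpa_equivI[OF assms] by blast
qed

lemma card_support_eq_sum_types: "wpa \<Phi> \<Longrightarrow> card (support \<Phi>) = (\<Sum>\<tau>\<in>pairs. type_count \<Phi> \<tau>)"
  using sum_point_types[of \<Phi> "\<lambda>_. 1::nat"] by simp

section \<open>Direct sums and coset actions\<close>

lemma wpa_plus_wpa:
  assumes \<Phi>: "wpa \<Phi>" and \<Psi>: "wpa \<Psi>"
  shows "wpa (wpa_plus \<Phi> \<Psi>)"
  by (rule wpaI)
     (auto simp: wpa_plus_def wpa_finite[OF \<Phi>] wpa_finite[OF \<Psi>] wpa_closed[OF \<Phi>] wpa_closed[OF \<Psi>]
        wpa_one[OF \<Phi>] wpa_one[OF \<Psi>] wpa_act_mult[OF \<Phi>] wpa_act_mult[OF \<Psi>]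
        wpa_weight_nonzero[OF \<Phi>] wpa_weight_nonzero[OF \<Psi>] wpa_weight[OF \<Phi>, simplified]
        wpa_weight[OF \<Psi>, simplified])

lemma type_count_plus:
  assumes \<Phi>: "wpa \<Phi>" and \<Psi>: "wpa \<Psi>"
  shows "type_count (wpa_plus \<Phi> \<Psi>) \<tau> = type_count \<Phi> \<tau> + type_count \<Psi> \<tau>"
proof -
  have "point_type (wpa_plus \<Phi> \<Psi>) (Inl p) = point_type \<Phi> p" if "p \<in> support \<Phi>" for p
    using that by (auto simp: point_type_def point_char_def stabilizer_def wpa_plus_def
        wpa_closed[OF \<Phi>] intro!: restrict_ext)
  moreover have "point_type (wpa_plus \<Phi> \<Psi>) (Inr q) = point_type \<Psi> q" if "q \<in> support \<Psi>" for q
    using that by (auto simp: point_type_def point_char_def stabilizer_def wpa_plus_def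
        wpa_closed[OF \<Psi>] intro!: restrict_ext)
  ultimately have "{p \<in> support (wpa_plus \<Phi> \<Psi>). point_type (wpa_plus \<Phi> \<Psi>) p = \<tau>} =
      {p \<in> support \<Phi>. point_type \<Phi> p = \<tau>} <+> {q \<in> support \<Psi>. point_type \<Psi> q = \<tau>}"
    by (auto simp: wpa_plus_def)
  then show ?thesis
    unfolding type_count_def using wpa_finite[OF \<Phi>] wpa_finite[OF \<Psi>]
    by (simp add: card_Plus)
qed

lemma wpa_sum_wpa:
  assumes "finite I" and F: "\<And>i. i \<in> I \<Longrightarrow> wpa (F i)"
  shows "wpa (wpa_sum I F)"
proof (rule wpaI)
  show "finite (support (wpa_sum I F))"
    using assms wpa_finite by (auto simp: wpa_sum_def)
next
  fix \<alpha> \<beta> p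
  assume "\<alpha> \<in> carrier G" "\<beta> \<in> carrier G" "p \<in> support (wpa_sum I F)"
  moreover obtain i x where "p = (i, x)" by fastforce
  ultimately show "weight (wpa_sum I F) (action (wpa_sum I F) \<alpha> p) *
      weight (wpa_sum I F) (action (wpa_sum I F) \<beta> p) =
      weight (wpa_sum I F) p * weight (wpa_sum I F) (action (wpa_sum I F) (\<alpha> \<otimes> \<beta>) p)"
    using wpa_weight[OF F] by (simp add: wpa_sum_def)
qed (auto simp: wpa_sum_def F wpa_closed[OF F] wpa_one[OF F] wpa_act_mult[OF F] wpa_weight_nonzero[OF F])

lemma type_count_sum:
  assumes "finite I" and F: "\<And>i. i \<in> I \<Longrightarrow> wpa (F i)"
  shows "type_count (wpa_sum I F) \<tau> = (\<Sum>i\<in>I. type_count (F i) \<tau>)"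
proof -
  have "point_type (wpa_sum I F) (i, p) = point_type (F i) p" if "i \<in> I" "p \<in> support (F i)" for i p
    using that by (auto simp: point_type_def point_char_def stabilizer_def wpa_sum_def
        wpa_closed[OF F] intro!: restrict_ext)
  then have "{p \<in> support (wpa_sum I F). point_type (wpa_sum I F) p = \<tau>} =
      (SIGMA i:I. {p \<in> support (F i). point_type (F i) p = \<tau>})"
    by (auto simp: wpa_sum_def)
  then show ?thesis
    unfolding type_count_def using assms wpa_finite[OF F] by simp
qed

lemma wpa_copies_wpa: "wpa \<Phi> \<Longrightarrow> wpa (wpa_copies k \<Phi>)"
  by (simp add: wpa_copies_def wpa_sum_wpa)

lemma type_count_copies: "wpa \<Phi> \<Longrightarrow> type_count (wpa_copies k \<Phi>) \<tau> = k * type_count \<Phi> \<tau>"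
  by (simp add: wpa_copies_def type_count_sum)

text \<open>Commutativity moves \<open>\<alpha>\<close> past \<open>\<beta>\<close>, so every point
  of the coset space has the stabiliser K itself and not just a conjugate.\<close>

lemma l_coset_fixed_iff:
  assumes K: "subgroup K G" and \<alpha>: "\<alpha> \<in> carrier G" and \<beta>: "\<beta> \<in> carrier G"
  shows "\<alpha> <# (\<beta> <# K) = \<beta> <# K \<longleftrightarrow> \<alpha> \<in> K"
proof -
  have *: "\<alpha> <# (\<beta> <# K) = \<beta> <# (\<alpha> <# K)"
    using assms subgroup.subset[OF K] by (simp add: lcos_m_assoc m_comm)
  show ?thesis
  proof
    assume "\<alpha> \<in> K"
    then show "\<alpha> <# (\<beta> <# K) = \<beta> <# K"
      unfolding * by (simp add: coset_join3[OF \<alpha> K])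
  next
    assume "\<alpha> <# (\<beta> <# K) = \<beta> <# K"
    then have "inv \<beta> <# (\<beta> <# (\<alpha> <# K)) = inv \<beta> <# (\<beta> <# K)"
      unfolding * by simp
    moreover have "\<alpha> <# K \<subseteq> carrier G"
      using \<alpha> subgroup.subset[OF K] by (rule l_coset_subset_G[rotated])
    ultimately have "\<alpha> <# K = K"
      using \<alpha> \<beta> subgroup.subset[OF K]
      by (simp add: lcos_m_assoc lcos_mult_one m_assoc[symmetric])
    then show "\<alpha> \<in> K"
      using lcos_self[OF \<alpha> K] by simp
  qed
qed

context
  fixes K \<xi>
  assumes pair: "(K, \<xi>) \<in> pairs"
begin

lemma coset_wpa_weight:
  assumes \<alpha>: "\<alpha> \<in> carrier G"
  shows "weight (coset_wpa G \<theta> K \<xi>) (\<alpha> <# K) = \<theta> \<alpha> / \<xi> \<alpha>"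
proof -
  have K: "subgroup K G" and \<xi>: "\<xi> \<in> dual G" "\<And>\<alpha>. \<alpha> \<in> K \<Longrightarrow> \<xi> \<alpha> = \<theta> \<alpha>"
    using pair by (auto simp: pairs_iff)
  have "\<theta> (\<alpha> \<otimes> \<kappa>) / \<xi> (\<alpha> \<otimes> \<kappa>) = \<theta> \<alpha> / \<xi> \<alpha>" if "\<kappa> \<in> K" for \<kappa>
    using that \<alpha> \<xi> subgroup.mem_carrier[OF K that] theta_nonzero by (simp add: theta_mult dual_iff)
  moreover have "\<alpha> <# K = (\<lambda>\<kappa>. \<alpha> \<otimes> \<kappa>) ` K"
    by (auto simp: l_coset_def)
  ultimately have "(\<lambda>\<alpha>. \<theta> \<alpha> / \<xi> \<alpha>) ` (\<alpha> <# K) = (\<lambda>_. \<theta> \<alpha> / \<xi> \<alpha>) ` K"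
    by (simp only: image_image) (intro image_cong refl)
  also have "\<dots> = {\<theta> \<alpha> / \<xi> \<alpha>}"
    by (rule image_constant) (rule subgroup.one_closed[OF K])
  finally show ?thesis by (simp add: coset_wpa_def)
qed

lemma coset_wpa_action:
  assumes "\<alpha> \<in> carrier G" "\<beta> \<in> carrier G"
  shows "action (coset_wpa G \<theta> K \<xi>) \<alpha> (\<beta> <# K) = (\<alpha> \<otimes> \<beta>) <# K"
proof -
  have "subgroup K G" using pair by (simp add: pairs_iff)
  then show ?thesis
    using assms subgroup.subset by (auto simp: coset_wpa_def LCOSETS_def lcos_m_assoc)
qed

lemma coset_wpa_support: "support (coset_wpa G \<theta> K \<xi>) = (\<lambda>\<beta>. \<beta> <# K) ` carrier G"
  by (auto simp: coset_wpa_def LCOSETS_def)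

lemma coset_wpa_wpa: "wpa (coset_wpa G \<theta> K \<xi>)"
proof (rule wpaI)
  have \<xi>: "\<xi> \<in> dual G" using pair by (simp add: pairs_iff)
  show "finite (support (coset_wpa G \<theta> K \<xi>))"
    using finite_carrier by (simp add: coset_wpa_support)
  show "action (coset_wpa G \<theta> K \<xi>) \<alpha> \<in> extensional (support (coset_wpa G \<theta> K \<xi>))" for \<alpha>
    by (simp add: coset_wpa_def)
  show "weight (coset_wpa G \<theta> K \<xi>) p \<noteq> 0" if "p \<in> support (coset_wpa G \<theta> K \<xi>)" for p
    using that theta_nonzero \<xi> by (auto simp: coset_wpa_support coset_wpa_weight dual_iff)
  show "weight (coset_wpa G \<theta> K \<xi>) (action (coset_wpa G \<theta> K \<xi>) \<alpha> p) *
      weight (coset_wpa G \<theta> K \<xi>) (action (coset_wpa G \<theta> K \<xi>) \<beta> p) =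
      weight (coset_wpa G \<theta> K \<xi>) p * weight (coset_wpa G \<theta> K \<xi>) (action (coset_wpa G \<theta> K \<xi>) (\<alpha> \<otimes> \<beta>) p)"
    if "\<alpha> \<in> carrier G" "\<beta> \<in> carrier G" "p \<in> support (coset_wpa G \<theta> K \<xi>)" for \<alpha> \<beta> p
    using that \<xi>
    by (auto simp: coset_wpa_support coset_wpa_weight coset_wpa_action theta_mult dual_iff mult_ac)
qed (auto simp: coset_wpa_support coset_wpa_action m_assoc)

lemma type_count_coset_wpa:
  "type_count (coset_wpa G \<theta> K \<xi>) \<tau> = (if \<tau> = (K, \<xi>) then index K else 0)"
proof -
  have K: "subgroup K G" and \<xi>: "\<xi> \<in> dual G"
    using pair by (auto simp: pairs_iff)
  have "point_type (coset_wpa G \<theta> K \<xi>) p = (K, \<xi>)" if p: "p \<in> support (coset_wpa G \<theta> K \<xi>)" for p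
  proof -
    obtain \<beta> where \<beta>: "\<beta> \<in> carrier G" "p = \<beta> <# K"
      using p by (auto simp: coset_wpa_support)
    have "stabilizer G (action (coset_wpa G \<theta> K \<xi>)) p = {\<alpha> \<in> carrier G. \<alpha> <# (\<beta> <# K) = \<beta> <# K}"
      using \<beta> p by (auto simp: stabilizer_def coset_wpa_def)
    also have "\<dots> = K"
      using l_coset_fixed_iff[OF K] \<beta> subgroup.mem_carrier[OF K] by auto
    finally have "stabilizer G (action (coset_wpa G \<theta> K \<xi>)) p = K" .
    \<comment> \<open>The weight is \<theta> / \<xi>, so in the quotient of the weights at \<beta>
      and \<alpha>\<beta>, multiplied by \<theta> \<alpha>, all values of \<theta> cancel and \<xi>
      \<alpha> remains.\<close>
    moreover have "point_char (coset_wpa G \<theta> K \<xi>) p = \<xi>"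
    proof (rule extensionalityI)
      show "point_char (coset_wpa G \<theta> K \<xi>) p \<alpha> = \<xi> \<alpha>" if "\<alpha> \<in> carrier G" for \<alpha>
        using that \<beta> \<xi> theta_nonzero
        by (simp add: point_char_def coset_wpa_action coset_wpa_weight theta_mult dual_iff)
    qed (use \<xi> in \<open>auto simp: point_char_def dual_iff\<close>)
    ultimately show ?thesis by (simp add: point_type_def)
  qed
  then have "{p \<in> support (coset_wpa G \<theta> K \<xi>). point_type (coset_wpa G \<theta> K \<xi>) p = \<tau>} =
      (if \<tau> = (K, \<xi>) then support (coset_wpa G \<theta> K \<xi>) else {})"
    by auto
  then show ?thesis
    by (simp add: type_count_def index_def coset_wpa_def)
qed

end

text \<open>Transport of structure along a bijection. It is needed because
  \<open>irreducible_wpa\<close> lets the summands range over actions on the same type of points as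
  the given one, whereas sums of coset actions live on other types.\<close>

lemma ex_wpa_on_support:
  fixes \<Psi> :: "('a, 'y) wpa" and S :: "'x set"
  assumes \<Psi>: "wpa \<Psi>" and "finite S" "card S = card (support \<Psi>)"
  shows "\<exists>\<Phi> :: ('a, 'x) wpa. wpa \<Phi> \<and> support \<Phi> = S \<and> (\<forall>\<tau>. type_count \<Phi> \<tau> = type_count \<Psi> \<tau>)"
proof -
  obtain f where f: "bij_betw f S (support \<Psi>)"
    using assms wpa_finite[OF \<Psi>] finite_same_card_bij by blast
  define g where "g = the_inv_into S f"
  have g: "bij_betw g (support \<Psi>) S"
    unfolding g_def using f by (rule bij_betw_the_inv_into)
  have gf: "g (f p) = p" and fS: "f p \<in> support \<Psi>" if "p \<in> S" for p
    using that f by (auto simp: g_def bij_betw_def the_inv_into_f_f)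
  have fg: "f (g q) = q" and gS: "g q \<in> S" if "q \<in> support \<Psi>" for q
    using that f g by (auto simp: g_def f_the_inv_into_f_bij_betw bij_betw_def)
  define \<Phi> :: "('a, 'x) wpa" where
    "\<Phi> = \<lparr>support = S, action = (\<lambda>\<alpha>. \<lambda>p\<in>S. g (action \<Psi> \<alpha> (f p))), weight = weight \<Psi> \<circ> f\<rparr>"
  have \<Phi>: "wpa \<Phi>"
    by (rule wpaI)
       (auto simp: \<Phi>_def assms gf fg gS fS wpa_closed[OF \<Psi>] wpa_one[OF \<Psi>] wpa_act_mult[OF \<Psi>]
          wpa_weight_nonzero[OF \<Psi>] wpa_weight[OF \<Psi>, simplified])
  have "point_type \<Phi> p = point_type \<Psi> (f p)" if p: "p \<in> S" for p
  proof -
    have "g (action \<Psi> \<alpha> (f p)) = p \<longleftrightarrow> action \<Psi> \<alpha> (f p) = f p" if "\<alpha> \<in> carrier G" for \<alpha>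
      using that p by (metis fg fS gf wpa_closed[OF \<Psi>])
    then have "stabilizer G (action \<Phi>) p = stabilizer G (action \<Psi>) (f p)"
      using p by (auto simp: stabilizer_def \<Phi>_def)
    moreover have "point_char \<Phi> p = point_char \<Psi> (f p)"
      unfolding point_char_def
      by (intro restrict_ext) (use p in \<open>simp add: \<Phi>_def fg fS wpa_closed[OF \<Psi>]\<close>)
    ultimately show ?thesis by (simp add: point_type_def)
  qed
  then have "f ` {p \<in> S. point_type \<Phi> p = \<tau>} = {q \<in> support \<Psi>. point_type \<Psi> q = \<tau>}" for \<tau>
    using f by (fastforce simp: bij_betw_def)
  then have "card {p \<in> S. point_type \<Phi> p = \<tau>} = card {q \<in> support \<Psi>. point_type \<Psi> q = \<tau>}" for \<tau>
    by (intro bij_betw_same_card[of f] bij_betw_subset[OF f]) auto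
  then have "type_count \<Phi> \<tau> = type_count \<Psi> \<tau>" for \<tau>
    by (simp add: type_count_def \<Phi>_def)
  with \<Phi> show ?thesis by (auto simp: \<Phi>_def)
qed

section \<open>Admissibility in terms of the numbers of points of each type\<close>

text \<open>The extension of Upsilon, by linearity, to all complex functions on types, so that
  differences of type counts can be inserted.\<close>

definition pairing :: "('a set \<times> ('a \<Rightarrow> complex) \<Rightarrow> complex) \<Rightarrow> 'a \<Rightarrow> 'a \<Rightarrow> complex" where
  "pairing N \<alpha> \<beta> = (\<Sum>\<tau>\<in>pairs. N \<tau> * (if \<alpha> \<in> fst \<tau> then snd \<tau> \<beta> else 0))"

definition common_fix :: "('a set \<times> ('a \<Rightarrow> complex) \<Rightarrow> nat) \<Rightarrow> 'a \<Rightarrow> 'a \<Rightarrow> nat" where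
  "common_fix N \<alpha> \<beta> = (\<Sum>\<tau>\<in>pairs. N \<tau> * (if \<alpha> \<in> fst \<tau> \<and> \<beta> \<in> fst \<tau> then 1 else 0))"

text \<open>\<open>N\<close> counts points while \<open>mu\<close> counts copies of W[K,\<xi>], each
  of which has \<open>index K\<close> points. Quantifying over \<open>mu\<close> also records that
  the counts are multiples of the index.\<close>

definition galois_count :: "('a set \<times> ('a \<Rightarrow> complex) \<Rightarrow> nat) \<Rightarrow> bool" where
  "galois_count N \<longleftrightarrow> (\<exists>mu. \<forall>(K, \<xi>)\<in>pairs. N (K, \<xi>) = mu K \<xi> * index K \<and>
     (\<forall>l::int. coprime l (int (group_exponent G)) \<longrightarrow> mu K \<xi> = mu K (char_pow G \<xi> l)))"

definition admissible_count :: "('a set \<times> ('a \<Rightarrow> complex) \<Rightarrow> nat) \<Rightarrow> bool" where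
  "admissible_count N \<longleftrightarrow> galois_count N \<and>
     (\<forall>\<alpha>\<in>carrier G. \<forall>\<beta>\<in>carrier G. pairing N \<alpha> \<beta> = pairing N \<beta> \<alpha>) \<and>
     (\<forall>\<alpha>\<in>carrier G. \<forall>\<beta>\<in>carrier G. norm (pairing N \<alpha> \<beta>) \<le> common_fix N \<alpha> \<beta>)"

text \<open>A copy of W[K,\<xi>] consists of \<open>index K\<close> points, all of type (K, \<xi>),
  so distinct pairs do not interfere.\<close>

lemma is_coset_decomposition_iff:
  assumes \<Phi>: "wpa \<Phi>"
  shows "is_coset_decomposition G \<theta> \<Phi> mu \<longleftrightarrow> (\<forall>(K, \<xi>)\<in>pairs. type_count \<Phi> (K, \<xi>) = mu K \<xi> * index K)"
proof -
  define F where "F = (\<lambda>(K, \<xi>). wpa_copies (mu K \<xi>) (coset_wpa G \<theta> K \<xi>))"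
  have F: "wpa (F \<sigma>)" if "\<sigma> \<in> pairs" for \<sigma>
    using that by (auto simp: F_def coset_wpa_wpa wpa_copies_wpa split: prod.splits)
  have "type_count (F \<sigma>) \<tau> = (if \<tau> = \<sigma> then mu (fst \<sigma>) (snd \<sigma>) * index (fst \<sigma>) else 0)"
    if "\<sigma> \<in> pairs" for \<sigma> \<tau>
    using that
    by (auto simp: F_def type_count_copies coset_wpa_wpa type_count_coset_wpa split: prod.splits)
  then have "type_count (wpa_sum pairs F) \<tau> = mu (fst \<tau>) (snd \<tau>) * index (fst \<tau>)" if "\<tau> \<in> pairs" for \<tau>
    using that finite_pairs by (simp add: type_count_sum F)
  then show ?thesis
    unfolding is_coset_decomposition_def F_def[symmetric]
    by (auto simp: wpa_equiv_iff_type_count \<Phi> wpa_sum_wpa finite_pairs F)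
qed

lemma admissible_iff: "admissible G \<theta> \<Phi> \<longleftrightarrow> wpa \<Phi> \<and> admissible_count (type_count \<Phi>)"
proof (cases "wpa \<Phi>")
  case True
  have "galois_invariant G \<theta> \<Phi> \<longleftrightarrow> galois_count (type_count \<Phi>)"
    unfolding galois_invariant_def galois_count_def is_coset_decomposition_iff[OF True]
    by (intro ex_cong1) auto
  moreover have "reciprocity G \<theta> \<Phi> \<longleftrightarrow> (\<forall>\<alpha>\<in>carrier G. \<forall>\<beta>\<in>carrier G.
      pairing (type_count \<Phi>) \<alpha> \<beta> = pairing (type_count \<Phi>) \<beta> \<alpha>)"
    by (simp add: reciprocity_def pairing_def Upsilon_eq_sum_types[OF True])
  moreover have "boundedness G \<theta> \<Phi> \<longleftrightarrow> (\<forall>\<alpha>\<in>carrier G. \<forall>\<beta>\<in>carrier G.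
      norm (pairing (type_count \<Phi>) \<alpha> \<beta>) \<le> common_fix (type_count \<Phi>) \<alpha> \<beta>)"
    unfolding boundedness_def
    by (simp add: Upsilon_eq_sum_types[OF True] card_Fix_eq_sum_types[OF True]
        flip: pairing_def common_fix_def)
  ultimately show ?thesis
    using True by (simp add: admissible_def admissible_count_def)
qed (simp add: admissible_def)

lemma admissible_count_cong:
  assumes "\<And>\<tau>. \<tau> \<in> pairs \<Longrightarrow> N \<tau> = M \<tau>"
  shows "admissible_count N \<longleftrightarrow> admissible_count M"
proof -
  have "pairing N = pairing M" "common_fix N = common_fix M"
    by (intro ext; simp add: pairing_def common_fix_def assms)+
  moreover have "galois_count N \<longleftrightarrow> galois_count M"
    unfolding galois_count_def using assms by (intro ex_cong1 ball_cong) auto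
  ultimately show ?thesis by (simp add: admissible_count_def)
qed

lemma pairing_sum:
  "pairing (\<lambda>\<tau>. of_nat (\<Sum>i\<in>I. N i \<tau>)) \<alpha> \<beta> = (\<Sum>i\<in>I. pairing (\<lambda>\<tau>. of_nat (N i \<tau>)) \<alpha> \<beta>)"
  unfolding pairing_def of_nat_sum sum_distrib_right by (rule sum.swap)

lemma common_fix_sum:
  "common_fix (\<lambda>\<tau>. \<Sum>i\<in>I. N i \<tau>) \<alpha> \<beta> = (\<Sum>i\<in>I. common_fix (N i) \<alpha> \<beta>)"
  unfolding common_fix_def sum_distrib_right by (rule sum.swap)

text \<open>Multiplicities add, the pairing is additive, and the bounds add by the triangle
  inequality.\<close>

lemma admissible_count_sum:
  assumes N: "\<And>i. i \<in> I \<Longrightarrow> admissible_count (N i)"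
  shows "admissible_count (\<lambda>\<tau>. \<Sum>i\<in>I. N i \<tau>)"
proof -
  have "\<exists>mu. \<forall>(K, \<xi>)\<in>pairs. N i (K, \<xi>) = mu K \<xi> * index K \<and>
     (\<forall>l::int. coprime l (int (group_exponent G)) \<longrightarrow> mu K \<xi> = mu K (char_pow G \<xi> l))"
    if "i \<in> I" for i
    using N[OF that] by (simp add: admissible_count_def galois_count_def)
  then obtain mu where mu: "\<And>i K \<xi>. \<lbrakk>i \<in> I; (K, \<xi>) \<in> pairs\<rbrakk> \<Longrightarrow> N i (K, \<xi>) = mu i K \<xi> * index K"
    "\<And>i K \<xi> l. \<lbrakk>i \<in> I; (K, \<xi>) \<in> pairs; coprime l (int (group_exponent G))\<rbrakk> \<Longrightarrow>
        mu i K \<xi> = mu i K (char_pow G \<xi> l)"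
    by (simp add: Ball_def split_def) metis
  have galois: "galois_count (\<lambda>\<tau>. \<Sum>i\<in>I. N i \<tau>)"
    unfolding galois_count_def
    by (rule exI[of _ "\<lambda>K \<xi>. \<Sum>i\<in>I. mu i K \<xi>"])
       (auto simp: sum_distrib_right mu(1) intro: sum.cong mu(2))
  have bound: "norm (\<Sum>i\<in>I. pairing (N i) \<alpha> \<beta>) \<le> real (\<Sum>i\<in>I. common_fix (N i) \<alpha> \<beta>)"
    if "\<alpha> \<in> carrier G" "\<beta> \<in> carrier G" for \<alpha> \<beta>
    unfolding of_nat_sum using N that by (intro sum_norm_le) (auto simp: admissible_count_def)
  have sym: "(\<Sum>i\<in>I. pairing (N i) \<alpha> \<beta>) = (\<Sum>i\<in>I. pairing (N i) \<beta> \<alpha>)"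
    if "\<alpha> \<in> carrier G" "\<beta> \<in> carrier G" for \<alpha> \<beta>
    using N that by (intro sum.cong refl) (simp add: admissible_count_def)
  show ?thesis
    unfolding admissible_count_def pairing_sum common_fix_sum
    by (intro conjI ballI galois bound sym)
qed

lemma admissible_sum:
  assumes "finite I" "\<And>i. i \<in> I \<Longrightarrow> admissible G \<theta> (F i)"
  shows "admissible G \<theta> (wpa_sum I F)"
proof -
  have "admissible_count (\<lambda>\<tau>. \<Sum>i\<in>I. type_count (F i) \<tau>)"
    using assms by (intro admissible_count_sum) (simp add: admissible_iff)
  moreover have "type_count (wpa_sum I F) = (\<lambda>\<tau>. \<Sum>i\<in>I. type_count (F i) \<tau>)"
    using assms by (intro ext type_count_sum) (simp_all add: admissible_iff)
  ultimately show ?thesis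
    using assms by (simp add: admissible_iff wpa_sum_wpa)
qed

lemma admissible_copies: "admissible G \<theta> \<Phi> \<Longrightarrow> admissible G \<theta> (wpa_copies k \<Phi>)"
  by (simp add: wpa_copies_def admissible_sum)

lemma admissible_equiv:
  assumes "wpa \<Phi>" "admissible G \<theta> \<Psi>" "wpa_equiv G \<Phi> \<Psi>"
  shows "admissible G \<theta> \<Phi>"
  using assms admissible_count_cong[of "type_count \<Phi>" "type_count \<Psi>"]
  by (auto simp: admissible_iff wpa_equiv_iff_type_count)

section \<open>The admissible coset actions\<close>

lemma group_exponent_pos: "0 < group_exponent G"
  and pow_group_exponent: "\<alpha> \<in> carrier G \<Longrightarrow> \<alpha> [^] group_exponent G = \<one>"
proof -
  have "0 < group_exponent G \<and> (\<forall>\<alpha>\<in>carrier G. \<alpha> [^] group_exponent G = \<one>)"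
    unfolding group_exponent_def by (rule LeastI[of _ "order G"]) (simp add: order_pos pow_order_eq_1)
  then show "0 < group_exponent G" "\<alpha> \<in> carrier G \<Longrightarrow> \<alpha> [^] group_exponent G = \<one>" by auto
qed

text \<open>By Bezout, raising an e-th root of unity to the power l can be undone by another
  power.\<close>

lemma root_of_unity_powi_eq_1_iff:
  fixes z :: complex
  assumes "z ^ e = 1" "0 < e" "coprime l (int e)"
  shows "z powi l = 1 \<longleftrightarrow> z = 1"
proof
  assume l: "z powi l = 1"
  have "z \<noteq> 0" using assms by (auto simp: power_0_left)
  obtain u v where "u * l + v * int e = 1"
    using assms(3) bezout_int[of l "int e"] by auto
  then have "z = z powi (l * u + int e * v)"
    by (simp add: mult.commute)
  also have "\<dots> = (z powi l) powi u * (z ^ e) powi v"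
    using \<open>z \<noteq> 0\<close> by (simp add: power_int_add power_int_mult power_int_of_nat)
  finally show "z = 1" using l assms(1) by simp
qed simp

text \<open>If \<theta> takes the value -1, the group exponent is even, so an exponent coprime to it
  is odd.\<close>

lemma theta_powi:
  assumes "\<alpha> \<in> carrier G" "coprime l (int (group_exponent G))"
  shows "\<theta> \<alpha> powi l = \<theta> \<alpha>"
proof (cases "\<theta> \<alpha> = 1")
  case False
  then have minus: "\<theta> \<alpha> = - 1" using theta_cases assms(1) by blast
  have "\<theta> \<alpha> ^ group_exponent G = 1"
    using theta_pow[OF assms(1), of "group_exponent G"] by (simp add: assms(1) pow_group_exponent theta_one)
  then have "even (group_exponent G)"
    unfolding minus by (metis minus_one_power_iff one_neq_neg_one)
  then have "odd l" using assms(2) by (meson coprime_common_divisor even_of_nat odd_one)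
  then show ?thesis unfolding minus by (simp add: power_int_minus_left)
qed simp

lemma char_pow_dual: "\<xi> \<in> dual G \<Longrightarrow> char_pow G \<xi> l \<in> dual G"
  by (auto simp: dual_iff char_pow_def power_int_mult_distrib)

lemma dual_powi_eq_1_iff:
  assumes "\<xi> \<in> dual G" "\<alpha> \<in> carrier G" "coprime l (int (group_exponent G))"
  shows "\<xi> \<alpha> powi l = 1 \<longleftrightarrow> \<xi> \<alpha> = 1"
  using assms group_exponent_pos pow_group_exponent[OF assms(2)]
  by (intro root_of_unity_powi_eq_1_iff) (simp_all flip: dual_pow add: dual_one)

text \<open>The preceding lemma is applied to the product of \<xi> and \<theta>, whose l-th power is
  the l-th power of \<xi> times \<theta>.\<close>

lemma dual_powi_eq_theta_iff:
  assumes "\<xi> \<in> dual G" "\<alpha> \<in> carrier G" "coprime l (int (group_exponent G))"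
  shows "\<xi> \<alpha> powi l = \<theta> \<alpha> \<longleftrightarrow> \<xi> \<alpha> = \<theta> \<alpha>"
proof -
  have "z = \<theta> \<alpha> \<longleftrightarrow> z * \<theta> \<alpha> = 1" for z
    using theta_cases[OF assms(2)] by (auto simp: minus_equation_iff)
  then show ?thesis
    using dual_powi_eq_1_iff[OF dual_mult[OF assms(1) theta_char_dual] assms(2,3)] assms(2)
    by (simp add: power_int_mult_distrib theta_powi[OF assms(2,3)])
qed

text \<open>This is the subgroup H_0 that enters A[H].\<close>

definition even_part :: "'a set \<Rightarrow> 'a set" where
  "even_part H = H \<inter> kernel G Cstar \<theta>"

lemma mem_even_part: "subgroup H G \<Longrightarrow> \<alpha> \<in> even_part H \<longleftrightarrow> \<alpha> \<in> H \<and> \<theta> \<alpha> = 1"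
  using subgroup.mem_carrier by (fastforce simp: even_part_def kernel_def Cstar_def)

lemma subgroup_even_part: "subgroup H G \<Longrightarrow> subgroup (even_part H) G"
proof (rule subgroupI)
  assume H: "subgroup H G"
  show "even_part H \<subseteq> carrier G"
    using subgroup.subset[OF H] by (auto simp: even_part_def)
  show "even_part H \<noteq> {}"
    using subgroup.one_closed[OF H] theta_one mem_even_part[OF H] by blast
  show "inv \<alpha> \<in> even_part H" if "\<alpha> \<in> even_part H" for \<alpha>
  proof -
    have \<alpha>: "\<alpha> \<in> H" "\<theta> \<alpha> = 1" "\<alpha> \<in> carrier G"
      using that mem_even_part[OF H] subgroup.mem_carrier[OF H] by auto
    then show ?thesis
      using subgroup.m_inv_closed[OF H] by (simp add: mem_even_part[OF H] theta_inv)
  qed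
  show "\<alpha> \<otimes> \<beta> \<in> even_part H" if "\<alpha> \<in> even_part H" "\<beta> \<in> even_part H" for \<alpha> \<beta>
    using that subgroup.m_closed[OF H] subgroup.mem_carrier[OF H]
    by (simp add: mem_even_part[OF H] theta_mult)
qed

text \<open>Translation by an element with \<theta> = -1 exchanges the two sign classes of H. The
  factor 2 obtained here is what later makes the pairing of A[H] symmetric.\<close>

lemma index_even_part:
  assumes H: "subgroup H G" and "even_part H \<noteq> H"
  shows "index (even_part H) = 2 * index H"
proof -
  obtain \<gamma> where \<gamma>: "\<gamma> \<in> H" "\<theta> \<gamma> = - 1"
    using assms mem_even_part[OF H] theta_cases subgroup.mem_carrier[OF H] by blast
  have minus: "\<theta> \<alpha> = - 1" if "\<alpha> \<in> H" "\<theta> \<alpha> \<noteq> 1" for \<alpha>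
    using that theta_cases subgroup.mem_carrier[OF H] by blast
  have "bij_betw (\<lambda>\<alpha>. \<gamma> \<otimes> \<alpha>) (even_part H) (H - even_part H)"
    by (rule bij_betw_byWitness[of _ "\<lambda>\<alpha>. inv \<gamma> \<otimes> \<alpha>"])
       (use \<gamma> subgroup.mem_carrier[OF H] subgroup.m_closed[OF H] subgroup.m_inv_closed[OF H]
         in \<open>auto simp: mem_even_part[OF H] m_assoc[symmetric] theta_mult theta_inv minus\<close>)
  then have "card (even_part H) = card (H - even_part H)"
    by (rule bij_betw_same_card)
  moreover have "even_part H \<subseteq> H" by (auto simp: even_part_def)
  moreover have "finite H"
    using finite_carrier subgroup.subset[OF H] finite_subset by blast
  ultimately have "card H = 2 * card (even_part H)"
    by (metis card_Diff_subset card_mono finite_subset le_add_diff_inverse mult_2)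
  then have "card (even_part H) * index (even_part H) = card (even_part H) * (2 * index H)"
    using card_mult_index[OF H] card_mult_index[OF subgroup_even_part[OF H]] by simp
  then show ?thesis
    using card_subgroup_pos[OF subgroup_even_part[OF H]] by simp
qed

text \<open>Both branches of the definition fit one formula: if \<open>even_part H = H\<close>, then
  \<theta> is trivial on H and the conditions \<phi> = \<theta> and \<phi> = 1 on H
  coincide.\<close>

lemma adm_coset_pairs_iff:
  assumes H: "subgroup H G"
  shows "(K, \<phi>) \<in> adm_coset_pairs G \<theta> H \<longleftrightarrow> \<phi> \<in> dual G \<and>
    (K = H \<and> (\<forall>\<alpha>\<in>H. \<phi> \<alpha> = \<theta> \<alpha>) \<or> K = even_part H \<and> even_part H \<noteq> H \<and> (\<forall>\<alpha>\<in>H. \<phi> \<alpha> = 1))"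
proof -
  have car: "\<alpha> \<in> carrier G" if "\<alpha> \<in> H" for \<alpha>
    using that subgroup.mem_carrier[OF H] by blast
  have "\<theta> \<alpha> * \<phi> \<alpha> = 1 \<longleftrightarrow> \<phi> \<alpha> = \<theta> \<alpha>" if "\<alpha> \<in> H" for \<alpha>
    using theta_cases[OF car[OF that]] by (auto simp: minus_equation_iff)
  then have 1: "H \<subseteq> kernel G Cstar (\<lambda>\<alpha>. \<theta> \<alpha> * \<phi> \<alpha>) \<longleftrightarrow> (\<forall>\<alpha>\<in>H. \<phi> \<alpha> = \<theta> \<alpha>)"
    using car by (auto simp: kernel_def Cstar_def)
  have 2: "H \<subseteq> kernel G Cstar \<phi> \<longleftrightarrow> (\<forall>\<alpha>\<in>H. \<phi> \<alpha> = 1)"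
    using car by (auto simp: kernel_def Cstar_def)
  have 3: "\<theta> \<alpha> = 1" if "even_part H = H" "\<alpha> \<in> H" for \<alpha>
    using that mem_even_part[OF H] by auto
  show ?thesis
    unfolding adm_coset_pairs_def even_part_def[symmetric] Let_def
    using 1 2 3 by auto
qed

lemma adm_coset_pairs_subset: "subgroup H G \<Longrightarrow> adm_coset_pairs G \<theta> H \<subseteq> pairs"
  using subgroup_even_part mem_even_part by (auto simp: adm_coset_pairs_iff pairs_iff)

lemma finite_adm_coset_pairs: "subgroup H G \<Longrightarrow> finite (adm_coset_pairs G \<theta> H)"
  using adm_coset_pairs_subset finite_pairs finite_subset by blast

lemma wpa_adm_coset_wpa: "subgroup H G \<Longrightarrow> wpa (adm_coset_wpa G \<theta> H)"
  unfolding adm_coset_wpa_def using adm_coset_pairs_subset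
  by (intro wpa_sum_wpa finite_adm_coset_pairs) (auto intro: coset_wpa_wpa)

lemma type_count_adm_coset_wpa:
  assumes H: "subgroup H G"
  shows "type_count (adm_coset_wpa G \<theta> H) \<tau> = (if \<tau> \<in> adm_coset_pairs G \<theta> H then index (fst \<tau>) else 0)"
proof -
  have "type_count (adm_coset_wpa G \<theta> H) \<tau> =
      (\<Sum>\<sigma>\<in>adm_coset_pairs G \<theta> H. type_count (case \<sigma> of (K, \<phi>) \<Rightarrow> coset_wpa G \<theta> K \<phi>) \<tau>)"
    unfolding adm_coset_wpa_def using adm_coset_pairs_subset[OF H]
    by (intro type_count_sum finite_adm_coset_pairs H) (auto intro: coset_wpa_wpa)
  also have "\<dots> = (\<Sum>\<sigma>\<in>adm_coset_pairs G \<theta> H. if \<tau> = \<sigma> then index (fst \<sigma>) else 0)"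
    using adm_coset_pairs_subset[OF H]
    by (intro sum.cong refl) (auto simp: type_count_coset_wpa split: prod.splits)
  finally show ?thesis
    using finite_adm_coset_pairs[OF H] by simp
qed

text \<open>Membership only asks whether \<xi> equals 1 or \<theta> on H, and both conditions are
  unaffected by passing to a coprime power.\<close>

lemma galois_count_adm_coset_wpa:
  assumes H: "subgroup H G"
  shows "galois_count (type_count (adm_coset_wpa G \<theta> H))"
proof -
  have "(K, \<xi>) \<in> adm_coset_pairs G \<theta> H \<longleftrightarrow> (K, char_pow G \<xi> l) \<in> adm_coset_pairs G \<theta> H"
    if "\<xi> \<in> dual G" "coprime l (int (group_exponent G))" for K \<xi> l
    using that subgroup.mem_carrier[OF H] char_pow_dual[OF that(1), of l, unfolded char_pow_def]
    by (simp add: adm_coset_pairs_iff[OF H] char_pow_def dual_powi_eq_1_iff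
        dual_powi_eq_theta_iff)
  then show ?thesis
    unfolding galois_count_def
    by (intro exI[of _ "\<lambda>K \<xi>. if (K, \<xi>) \<in> adm_coset_pairs G \<theta> H then 1 else 0"])
       (auto simp: type_count_adm_coset_wpa[OF H] pairs_iff)
qed

text \<open>The second family of A[H] consists of characters trivial on H and is present only if
  \<theta> is nontrivial on H, so \<theta> never occurs there.\<close>

lemma type_count_adm_coset_wpa_theta:
  assumes H: "subgroup H G"
  shows "type_count (adm_coset_wpa G \<theta> H) (K, theta_char) = (if K = H then index H else 0)"
proof -
  have "\<alpha> \<in> carrier G" if "\<alpha> \<in> H" for \<alpha>
    using that subgroup.mem_carrier[OF H] by blast
  then have "(K, theta_char) \<in> adm_coset_pairs G \<theta> H \<longleftrightarrow> K = H"
    using mem_even_part[OF H] by (auto simp: adm_coset_pairs_iff[OF H] theta_char_dual)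
  then show ?thesis by (simp add: type_count_adm_coset_wpa[OF H])
qed

end

section \<open>Cyclic groups\<close>

text \<open>Natural exponents suffice in a finite group, and they let division with remainder run on
  \<open>nat\<close>.\<close>

locale cyclic_degenerate_group = degenerate_group G \<theta>
  for G :: "('a, 'm) monoid_scheme" (structure) and \<theta> +
  fixes g :: 'a
  assumes generator: "g \<in> carrier G"
    and powers: "\<alpha> \<in> carrier G \<Longrightarrow> \<exists>i::nat. \<alpha> = g [^] i"
begin

section \<open>Subgroups of a finite cyclic group\<close>

lemma ord_generator: "ord g = order G"
proof -
  have "generate G {g} = carrier G"
    using generate_pow_on_finite_carrier[OF finite_carrier generator] generator powers by auto
  then show ?thesis
    using generate_pow_card[OF generator] by (simp add: order_def)
qed

lemma pow_generator_eq_one_iff: "g [^] (i::nat) = \<one> \<longleftrightarrow> order G dvd i"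
  using pow_eq_id[OF generator] ord_generator by simp

lemma subgroup_pow_card:
  assumes "subgroup K G" "\<alpha> \<in> K"
  shows "\<alpha> [^] card K = \<one>"
proof -
  interpret K: group "G\<lparr>carrier := K\<rparr>"
    using assms(1) by (rule subgroup_imp_group)
  show ?thesis
    using K.pow_order_eq_1[of \<alpha>] assms(2) by (simp add: order_def nat_pow_def)
qed

text \<open>If the i-th power lies in K, its \<open>card K\<close>-th power is the unit, so
  \<open>card K * index K\<close> divides \<open>i * card K\<close>. Hence K lies among the powers
  \<open>f j\<close> with j below \<open>card K\<close>; there are at most \<open>card K\<close> of
  these, so all of them belong to K.\<close>

lemma pow_generator_mem_iff:
  assumes K: "subgroup K G"
  shows "g [^] (i::nat) \<in> K \<longleftrightarrow> index K dvd i"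
proof -
  have dvd: "index K dvd i" if "g [^] i \<in> K" for i :: nat
  proof -
    have "g [^] (i * card K) = \<one>"
      using subgroup_pow_card[OF K that] generator by (simp add: nat_pow_pow)
    then have "card K * index K dvd i * card K"
      by (simp add: pow_generator_eq_one_iff card_mult_index[OF K])
    then show ?thesis
      using card_subgroup_pos[OF K] by (simp add: mult.commute)
  qed
  define f where "f j = g [^] (index K * j)" for j
  have f_mod: "f j = f (j mod card K)" for j
  proof -
    have "index K * (card K * (j div card K) + j mod card K) =
        card K * index K * (j div card K) + index K * (j mod card K)"
      by (simp only: distrib_left mult_ac)
    then have "index K * j = order G * (j div card K) + index K * (j mod card K)"
      by (simp add: card_mult_index[OF K])
    then have "f j = g [^] (order G * (j div card K)) \<otimes> f (j mod card K)"
      using generator by (simp add: f_def nat_pow_mult)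
    moreover have "g [^] (order G * (j div card K)) = \<one>"
      by (simp add: pow_generator_eq_one_iff)
    ultimately show ?thesis using generator by (simp add: f_def)
  qed
  have "K \<subseteq> f ` {..<card K}"
  proof
    fix \<alpha> assume "\<alpha> \<in> K"
    moreover obtain i :: nat where i: "\<alpha> = g [^] i"
      using powers subgroup.mem_carrier[OF K \<open>\<alpha> \<in> K\<close>] by blast
    ultimately obtain j where "\<alpha> = f j"
      using dvd[of i] by (auto simp: f_def)
    then show "\<alpha> \<in> f ` {..<card K}"
      using f_mod[of j] card_subgroup_pos[OF K] by auto
  qed
  then have "K = f ` {..<card K}"
    using card_image_le[of "{..<card K}" f] by (intro card_seteq) auto
  then have "f j \<in> K" for j
    using f_mod[of j] card_subgroup_pos[OF K] by (metis imageI lessThan_iff mod_less_divisor)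
  then show ?thesis
    using dvd by (auto simp: f_def)
qed

lemma subgroup_eq_of_card_eq:
  assumes K: "subgroup K G" and L: "subgroup L G" and "card K = card L"
  shows "K = L"
proof -
  have "index K = index L"
    using card_mult_index[OF K] card_mult_index[OF L] assms(3) card_subgroup_pos[OF L]
    by (metis mult_left_cancel not_gr_zero)
  then have "\<alpha> \<in> K \<longleftrightarrow> \<alpha> \<in> L" if "\<alpha> \<in> carrier G" for \<alpha>
    using powers[OF that] pow_generator_mem_iff[OF K] pow_generator_mem_iff[OF L] by auto
  then show ?thesis
    using subgroup.mem_carrier[OF K] subgroup.mem_carrier[OF L] by auto
qed

text \<open>The property obtained says that \<open>\<alpha>\<close> generates K. It is phrased
  through subgroups containing \<open>\<alpha>\<close> because these are the first components that
  contribute to \<open>pairing D \<alpha>\<close>.\<close>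

lemma subgroup_principal:
  assumes K: "subgroup K G"
  obtains \<alpha> where "\<alpha> \<in> K" "\<And>L. \<lbrakk>subgroup L G; \<alpha> \<in> L\<rbrakk> \<Longrightarrow> K \<subseteq> L"
proof
  show "g [^] index K \<in> K"
    by (simp add: pow_generator_mem_iff[OF K])
  fix L assume L: "subgroup L G" "g [^] index K \<in> L"
  show "K \<subseteq> L"
  proof
    fix \<beta> assume \<beta>: "\<beta> \<in> K"
    then obtain i :: nat where "\<beta> = g [^] i"
      using powers subgroup.mem_carrier[OF K] by blast
    then show "\<beta> \<in> L"
      using \<beta> L dvd_trans by (auto simp: pow_generator_mem_iff[OF K] pow_generator_mem_iff[OF L(1)])
  qed
qed

text \<open>This is the well-definedness of the character that sends the generator to z.\<close>

lemma pow_eq_of_root_of_unity: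
  fixes z :: complex
  assumes "z ^ order G = 1" "g [^] (i::nat) = g [^] (j::nat)"
  shows "z ^ i = z ^ j"
proof -
  have "z ^ a = z ^ b" if "g [^] (a::nat) = g [^] (b::nat)" "a \<le> b" for a b
  proof -
    have "g [^] a \<otimes> g [^] (b - a) = g [^] b"
      using that(2) generator by (simp add: nat_pow_mult)
    then have "g [^] a \<otimes> g [^] (b - a) = g [^] a \<otimes> \<one>"
      using that(1) generator by simp
    then have "g [^] (b - a) = \<one>"
      using generator by (simp add: l_cancel del: r_one)
    then obtain k where "b - a = order G * k"
      by (auto simp: pow_generator_eq_one_iff)
    then have "z ^ (b - a) = 1"
      using assms(1) by (simp add: power_mult)
    then show ?thesis
      using that(2) by (metis le_add_diff_inverse mult_1_right power_add)
  qed
  from this[of i j] this[of j i] show ?thesis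
    using assms(2) by (metis nat_le_linear)
qed

text \<open>A character that sends the generator to a primitive root of unity of order
  \<open>index H\<close> has kernel exactly H.\<close>

lemma ex_dual_separating:
  assumes H: "subgroup H G" and \<beta>: "\<beta> \<in> carrier G" "\<beta> \<notin> H"
  obtains \<chi> where "\<chi> \<in> dual G" "\<And>\<alpha>. \<alpha> \<in> H \<Longrightarrow> \<chi> \<alpha> = 1" "\<chi> \<beta> \<noteq> 1"
proof -
  define m where "m = index H"
  have m: "0 < m" using index_pos[OF H] by (simp add: m_def)
  have bij: "bij_betw (\<lambda>k. cis (2 * pi * real k / real m)) {..<m} {z. z ^ m = 1}"
    using m by (rule bij_betw_roots_unity)
  define z where "z = cis (2 * pi / real m)"
  have z_pow: "z ^ k = cis (2 * pi * real k / real m)" for k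
    by (simp add: z_def DeMoivre mult_ac)
  have zm: "z ^ m = 1"
    using m by (simp add: z_pow)
  have zn: "z ^ order G = 1"
    using zm by (metis card_mult_index[OF H] m_def mult.commute power_mult power_one)
  \<comment> \<open>Primitivity of z: exponents are reduced modulo m, and below m the powers of z
    are distinct because they enumerate the m-th roots of unity.\<close>
  have z_eq_1: "z ^ k = 1 \<longleftrightarrow> m dvd k" for k
  proof -
    have "z ^ k = z ^ (m * (k div m) + k mod m)" by simp
    also have "\<dots> = z ^ (k mod m)"
      unfolding power_add power_mult zm by simp
    finally have "z ^ k = 1 \<longleftrightarrow> z ^ (k mod m) = z ^ 0" by simp
    also have "\<dots> \<longleftrightarrow> k mod m = 0"
      using bij m unfolding z_pow bij_betw_def by (intro inj_on_eq_iff) auto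
    finally show ?thesis by (simp add: dvd_eq_mod_eq_0)
  qed
  define \<chi> where "\<chi> = (\<lambda>\<alpha>\<in>carrier G. z ^ (SOME i::nat. \<alpha> = g [^] i))"
  have \<chi>: "\<chi> (g [^] i) = z ^ i" for i :: nat
  proof -
    have "g [^] i = g [^] (SOME j::nat. g [^] i = g [^] j)"
      by (rule someI[of "\<lambda>j. g [^] i = g [^] j" i]) simp
    from pow_eq_of_root_of_unity[OF zn this] show ?thesis
      using generator by (simp add: \<chi>_def)
  qed
  show ?thesis
  proof
    show "\<chi> \<in> dual G"
      unfolding dual_iff
    proof (intro conjI ballI)
      show "\<chi> \<in> extensional (carrier G)" by (simp add: \<chi>_def)
      fix \<alpha> \<gamma> assume "\<alpha> \<in> carrier G" "\<gamma> \<in> carrier G"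
      then obtain i j :: nat where "\<alpha> = g [^] i" "\<gamma> = g [^] j" using powers by metis
      then show "\<chi> (\<alpha> \<otimes> \<gamma>) = \<chi> \<alpha> * \<chi> \<gamma>"
        using generator by (simp add: nat_pow_mult \<chi> power_add)
    next
      fix \<alpha> assume "\<alpha> \<in> carrier G"
      then show "\<chi> \<alpha> \<noteq> 0" by (simp add: \<chi>_def z_def)
    qed
    show "\<chi> \<alpha> = 1" if "\<alpha> \<in> H" for \<alpha>
      using that powers[OF subgroup.mem_carrier[OF H that]]
      by (auto simp: \<chi> z_eq_1 m_def pow_generator_mem_iff[OF H])
    show "\<chi> \<beta> \<noteq> 1"
      using \<beta> powers[OF \<beta>(1)] by (auto simp: \<chi> z_eq_1 m_def pow_generator_mem_iff[OF H])
  qed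
qed

section \<open>Annihilators of subgroups and character sums over them\<close>

definition annihilator :: "'a set \<Rightarrow> ('a \<Rightarrow> complex) set" where
  "annihilator H = {\<phi> \<in> dual G. \<forall>\<alpha>\<in>H. \<phi> \<alpha> = 1}"

lemma finite_annihilator: "finite (annihilator H)"
  using finite_dual by (simp add: annihilator_def)

lemma sum_annihilator:
  assumes H: "subgroup H G" and \<beta>: "\<beta> \<in> carrier G"
  shows "(\<Sum>\<phi>\<in>annihilator H. \<phi> \<beta>) = (if \<beta> \<in> H then of_nat (card (annihilator H)) else 0)"
proof (cases "\<beta> \<in> H")
  case True
  then show ?thesis by (simp add: annihilator_def)
next
  case False
  obtain \<chi> where \<chi>: "\<chi> \<in> dual G" "\<And>\<alpha>. \<alpha> \<in> H \<Longrightarrow> \<chi> \<alpha> = 1" "\<chi> \<beta> \<noteq> 1"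
    using ex_dual_separating[OF H \<beta> False] by blast
  have car: "\<alpha> \<in> carrier G" if "\<alpha> \<in> H" for \<alpha>
    using that subgroup.mem_carrier[OF H] by blast
  have nz: "\<chi> \<alpha> \<noteq> 0" if "\<alpha> \<in> carrier G" for \<alpha>
    using that \<chi>(1) by (simp add: dual_iff)
  \<comment> \<open>Multiplication by \<open>\<chi>\<close> permutes the annihilator since
    \<open>\<chi>\<close> is trivial on H; it scales the sum by \<open>\<chi> \<beta>\<close>, which
    is not 1.\<close>
  have "(\<Sum>\<phi>\<in>annihilator H. \<phi> \<beta>) = (\<Sum>\<phi>\<in>annihilator H. (\<lambda>\<alpha>\<in>carrier G. \<chi> \<alpha> * \<phi> \<alpha>) \<beta>)"
  proof (rule sum.reindex_bij_witness[of _ "\<lambda>\<phi>. \<lambda>\<alpha>\<in>carrier G. \<chi> \<alpha> * \<phi> \<alpha>"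
        "\<lambda>\<phi>. \<lambda>\<alpha>\<in>carrier G. \<phi> \<alpha> / \<chi> \<alpha>"])
    fix \<phi> assume \<phi>: "\<phi> \<in> annihilator H"
    then have "\<phi> \<in> extensional (carrier G)" by (simp add: annihilator_def dual_iff)
    then show "(\<lambda>\<alpha>\<in>carrier G. \<chi> \<alpha> * (\<lambda>\<alpha>\<in>carrier G. \<phi> \<alpha> / \<chi> \<alpha>) \<alpha>) = \<phi>"
      "(\<lambda>\<alpha>\<in>carrier G. (\<lambda>\<alpha>\<in>carrier G. \<chi> \<alpha> * \<phi> \<alpha>) \<alpha> / \<chi> \<alpha>) = \<phi>"
      using nz by (auto intro!: extensionalityI[of _ "carrier G"])
    show "(\<lambda>\<alpha>\<in>carrier G. \<chi> \<alpha> * \<phi> \<alpha>) \<in> annihilator H"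
      "(\<lambda>\<alpha>\<in>carrier G. \<phi> \<alpha> / \<chi> \<alpha>) \<in> annihilator H"
      using \<phi> dual_mult[OF \<chi>(1)] dual_divide[OF _ \<chi>(1)] by (auto simp: annihilator_def car \<chi>(2))
    show "(\<lambda>\<alpha>\<in>carrier G. \<chi> \<alpha> * (\<lambda>\<alpha>\<in>carrier G. \<phi> \<alpha> / \<chi> \<alpha>) \<alpha>) \<beta> = \<phi> \<beta>"
      using \<beta> nz by simp
  qed
  also have "\<dots> = \<chi> \<beta> * (\<Sum>\<phi>\<in>annihilator H. \<phi> \<beta>)"
    using \<beta> by (simp add: sum_distrib_left)
  finally show ?thesis using False \<chi>(3) by simp
qed

text \<open>The double sum of \<phi> \<beta> over the carrier and the annihilator is evaluated in
  both orders: for fixed \<beta> only elements of H contribute, for fixed \<phi> only the trivial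
  character does.\<close>

lemma card_annihilator:
  assumes H: "subgroup H G"
  shows "card (annihilator H) = index H"
proof -
  \<comment> \<open>The trivial character, made extensional; dividing by it brings the sum into the
    form of \<open>dual_orthogonality\<close>.\<close>
  define \<epsilon> :: "'a \<Rightarrow> complex" where "\<epsilon> = (\<lambda>\<alpha>\<in>carrier G. 1)"
  have \<epsilon>: "\<epsilon> \<in> annihilator H" "\<epsilon> \<in> dual G"
    using subgroup.mem_carrier[OF H] by (auto simp: \<epsilon>_def annihilator_def dual_iff)
  have "H \<subseteq> carrier G" using H by (rule subgroup.subset)
  have "(\<Sum>\<beta>\<in>carrier G. \<Sum>\<phi>\<in>annihilator H. \<phi> \<beta>) = of_nat (card H) * of_nat (card (annihilator H))"
    using finite_carrier \<open>H \<subseteq> carrier G\<close>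
    by (simp add: sum_annihilator[OF H] sum.If_cases Int_absorb1)
  moreover have "(\<Sum>\<beta>\<in>carrier G. \<Sum>\<phi>\<in>annihilator H. \<phi> \<beta>) =
      (\<Sum>\<phi>\<in>annihilator H. \<Sum>\<beta>\<in>carrier G. \<phi> \<beta> / \<epsilon> \<beta>)"
    by (subst sum.swap) (simp add: \<epsilon>_def)
  moreover have "\<dots> = (\<Sum>\<phi>\<in>annihilator H. if \<phi> = \<epsilon> then of_nat (order G) else 0)"
    by (intro sum.cong refl dual_orthogonality \<epsilon>(2)) (simp add: annihilator_def)
  moreover have "\<dots> = of_nat (order G)"
    using \<epsilon>(1) finite_annihilator by simp
  ultimately have "(of_nat (card H * card (annihilator H)) :: complex) = of_nat (card H * index H)"
    by (simp add: card_mult_index[OF H])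
  then have "card H * card (annihilator H) = card H * index H"
    by (rule of_nat_eq_iff[THEN iffD1])
  then show ?thesis using card_subgroup_pos[OF H] by simp
qed

text \<open>Multiplication by \<theta> is an involution that exchanges the annihilator of H with the
  characters agreeing with \<theta> on H.\<close>

lemma sum_theta_coset:
  assumes H: "subgroup H G"
  shows "(\<Sum>\<phi>\<in>{\<phi> \<in> dual G. \<forall>\<alpha>\<in>H. \<phi> \<alpha> = \<theta> \<alpha>}. f \<phi>) =
    (\<Sum>\<phi>\<in>annihilator H. f (\<lambda>\<alpha>\<in>carrier G. \<theta> \<alpha> * \<phi> \<alpha>))"
proof -
  let ?t = "\<lambda>\<phi>. \<lambda>\<alpha>\<in>carrier G. \<theta> \<alpha> * \<phi> \<alpha>"
  have car: "\<alpha> \<in> carrier G" if "\<alpha> \<in> H" for \<alpha>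
    using that subgroup.mem_carrier[OF H] by blast
  have dual: "?t \<phi> \<in> dual G" if "\<phi> \<in> dual G" for \<phi>
  proof -
    have "?t \<phi> = (\<lambda>\<alpha>\<in>carrier G. theta_char \<alpha> * \<phi> \<alpha>)"
      by (intro restrict_ext) simp
    then show ?thesis using dual_mult[OF theta_char_dual that] by simp
  qed
  have tt: "?t (?t \<phi>) = \<phi>" if "\<phi> \<in> dual G" for \<phi>
    using dual[OF dual[OF that]] that
    by (rule dual_eqI) (simp add: theta_square mult.assoc[symmetric])
  show ?thesis
  proof (rule sum.reindex_bij_witness[of _ ?t ?t])
    fix \<phi> assume "\<phi> \<in> {\<phi> \<in> dual G. \<forall>\<alpha>\<in>H. \<phi> \<alpha> = \<theta> \<alpha>}"
    then have \<phi>: "\<phi> \<in> dual G" "\<forall>\<alpha>\<in>H. \<phi> \<alpha> = \<theta> \<alpha>" by auto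
    show "?t (?t \<phi>) = \<phi>" by (rule tt[OF \<phi>(1)])
    then show "f (?t (?t \<phi>)) = f \<phi>" by (rule arg_cong)
    show "?t \<phi> \<in> annihilator H"
      using \<phi> dual[OF \<phi>(1)] by (simp add: annihilator_def car theta_square)
  next
    fix \<phi> assume "\<phi> \<in> annihilator H"
    then have \<phi>: "\<phi> \<in> dual G" "\<forall>\<alpha>\<in>H. \<phi> \<alpha> = 1" by (auto simp: annihilator_def)
    show "?t (?t \<phi>) = \<phi>" by (rule tt[OF \<phi>(1)])
    show "?t \<phi> \<in> {\<phi> \<in> dual G. \<forall>\<alpha>\<in>H. \<phi> \<alpha> = \<theta> \<alpha>}"
      using \<phi> dual[OF \<phi>(1)] by (simp add: car)
  qed
qed

text \<open>Both families of A[H] are parametrised by the same annihilator, and the 2 is the ratio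
  of the two indices. One formula serves the pairing, the common fixed points and the
  degree.\<close>

lemma sum_type_count_adm:
  fixes f :: "'a set \<times> ('a \<Rightarrow> complex) \<Rightarrow> 'b :: comm_semiring_1"
  assumes H: "subgroup H G"
  shows "(\<Sum>\<tau>\<in>pairs. of_nat (type_count (adm_coset_wpa G \<theta> H) \<tau>) * f \<tau>) =
    of_nat (index H) * ((\<Sum>\<phi>\<in>annihilator H. f (H, \<lambda>\<alpha>\<in>carrier G. \<theta> \<alpha> * \<phi> \<alpha>)) +
      (if even_part H = H then 0 else 2 * (\<Sum>\<phi>\<in>annihilator H. f (even_part H, \<phi>))))"
proof -
  define T where "T = {\<phi> \<in> dual G. \<forall>\<alpha>\<in>H. \<phi> \<alpha> = \<theta> \<alpha>}"
  have fin: "finite T" using finite_dual by (simp add: T_def)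
  have T: "(\<Sum>\<tau>\<in>Pair H ` T. of_nat (index (fst \<tau>)) * f \<tau>) =
      of_nat (index H) * (\<Sum>\<phi>\<in>annihilator H. f (H, \<lambda>\<alpha>\<in>carrier G. \<theta> \<alpha> * \<phi> \<alpha>))"
    by (simp add: sum.reindex inj_on_def sum_distrib_left T_def sum_theta_coset[OF H])
  have "(\<Sum>\<tau>\<in>pairs. of_nat (type_count (adm_coset_wpa G \<theta> H) \<tau>) * f \<tau>) =
      (\<Sum>\<tau>\<in>adm_coset_pairs G \<theta> H. of_nat (index (fst \<tau>)) * f \<tau>)"
    using finite_pairs adm_coset_pairs_subset[OF H]
    by (intro sum.mono_neutral_cong_right) (auto simp: type_count_adm_coset_wpa[OF H])
  also have "\<dots> = of_nat (index H) * ((\<Sum>\<phi>\<in>annihilator H. f (H, \<lambda>\<alpha>\<in>carrier G. \<theta> \<alpha> * \<phi> \<alpha>)) +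
      (if even_part H = H then 0 else 2 * (\<Sum>\<phi>\<in>annihilator H. f (even_part H, \<phi>))))"
  proof (cases "even_part H = H")
    case True
    then have "adm_coset_pairs G \<theta> H = Pair H ` T"
      by (auto simp: adm_coset_pairs_iff[OF H] T_def)
    then show ?thesis using True T by simp
  next
    case False
    then have "adm_coset_pairs G \<theta> H = Pair H ` T \<union> Pair (even_part H) ` annihilator H"
      by (auto simp: adm_coset_pairs_iff[OF H] T_def annihilator_def)
    moreover have "Pair H ` T \<inter> Pair (even_part H) ` annihilator H = {}"
      using False by auto
    moreover have "(\<Sum>\<tau>\<in>Pair (even_part H) ` annihilator H. of_nat (index (fst \<tau>)) * f \<tau>) =
        of_nat (index H) * (2 * (\<Sum>\<phi>\<in>annihilator H. f (even_part H, \<phi>)))"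
      by (simp add: sum.reindex inj_on_def index_even_part[OF H False] sum_distrib_left mult_ac)
    ultimately show ?thesis
      using False T fin finite_annihilator by (simp add: sum.union_disjoint distrib_left)
  qed
  finally show ?thesis .
qed

text \<open>One factor \<open>index H\<close> is the number of points of a coset action, the other
  comes from summing \<phi> \<beta> over the annihilator, which also confines \<beta> to H.\<close>

lemma pairing_adm_coset_wpa:
  assumes H: "subgroup H G" and "\<alpha> \<in> carrier G" "\<beta> \<in> carrier G"
  shows "pairing (type_count (adm_coset_wpa G \<theta> H)) \<alpha> \<beta> =
    of_nat ((index H)\<^sup>2) * (if \<beta> \<in> H then (if \<alpha> \<in> H then \<theta> \<beta> else 0) +
      (if even_part H \<noteq> H \<and> \<alpha> \<in> even_part H then 2 else 0) else 0)"
  unfolding pairing_def sum_type_count_adm[OF H] using assms(2,3)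
  by (cases "\<alpha> \<in> H"; cases "\<alpha> \<in> even_part H"; cases "\<beta> \<in> H")
     (simp_all add: sum_annihilator[OF H] card_annihilator[OF H] sum_distrib_left[symmetric]
        power2_eq_square distrib_left)

lemma common_fix_adm_coset_wpa:
  assumes H: "subgroup H G"
  shows "common_fix (type_count (adm_coset_wpa G \<theta> H)) \<alpha> \<beta> =
    (index H)\<^sup>2 * ((if \<alpha> \<in> H \<and> \<beta> \<in> H then 1 else 0) +
      (if even_part H \<noteq> H \<and> \<alpha> \<in> even_part H \<and> \<beta> \<in> even_part H then 2 else 0))"
  using sum_type_count_adm[OF H, of "\<lambda>\<tau>. if \<alpha> \<in> fst \<tau> \<and> \<beta> \<in> fst \<tau> then 1 else (0::nat)"]
  by (simp add: common_fix_def card_annihilator[OF H] power2_eq_square algebra_simps)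

text \<open>If \<theta> is nontrivial on H, the pairing on H \<times> H is the squared index times 1
  + \<theta> \<alpha> + \<theta> \<beta>. Its absolute value is 3 or 1 times the squared index,
  according to whether both signs are positive, which is the number of common fixed points: the
  bound is attained.\<close>

lemma admissible_adm_coset_wpa:
  assumes H: "subgroup H G"
  shows "admissible G \<theta> (adm_coset_wpa G \<theta> H)"
proof -
  have mem: "\<alpha> \<in> even_part H \<longleftrightarrow> \<alpha> \<in> H \<and> \<theta> \<alpha> = 1" for \<alpha>
    by (rule mem_even_part[OF H])
  have even: "\<theta> \<alpha> = 1" if "even_part H = H" "\<alpha> \<in> H" for \<alpha>
    using that mem by auto
  have "pairing (type_count (adm_coset_wpa G \<theta> H)) \<alpha> \<beta> = pairing (type_count (adm_coset_wpa G \<theta> H)) \<beta> \<alpha>"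
    if "\<alpha> \<in> carrier G" "\<beta> \<in> carrier G" for \<alpha> \<beta>
    using that theta_cases[OF that(1)] theta_cases[OF that(2)] even
    by (auto simp: pairing_adm_coset_wpa[OF H] mem)
  moreover have "norm (pairing (type_count (adm_coset_wpa G \<theta> H)) \<alpha> \<beta>)
      \<le> common_fix (type_count (adm_coset_wpa G \<theta> H)) \<alpha> \<beta>"
    if "\<alpha> \<in> carrier G" "\<beta> \<in> carrier G" for \<alpha> \<beta>
    using that theta_cases[OF that(1)] theta_cases[OF that(2)] even
    by (auto simp: pairing_adm_coset_wpa[OF H] common_fix_adm_coset_wpa[OF H] mem norm_mult norm_power)
  ultimately show ?thesis
    using wpa_adm_coset_wpa[OF H] galois_count_adm_coset_wpa[OF H]
    by (simp add: admissible_iff admissible_count_def)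
qed

text \<open>The family over H has \<open>index H\<close> members of degree \<open>index H\<close>;
  the family over \<open>even_part H\<close>, if present, has as many members of twice that degree,
  whence 1 + 2 = 3.\<close>

lemma degree_adm_coset_wpa:
  assumes H: "subgroup H G"
  shows "wpa_degree (adm_coset_wpa G \<theta> H) = (if even_part H = H then 1 else 3) * (index H)\<^sup>2"
  using sum_type_count_adm[OF H, of "\<lambda>_. 1::nat"]
  by (simp add: wpa_degree_def card_support_eq_sum_types[OF wpa_adm_coset_wpa[OF H]]
      card_annihilator[OF H] power2_eq_square)

section \<open>Reciprocity on a cyclic group\<close>

text \<open>Only pairs whose subgroup contains \<open>\<alpha>\<close> contribute, and their
  characters agree with \<theta> at \<open>\<alpha>\<close>.\<close>

lemma pairing_shift:
  assumes "\<alpha> \<in> carrier G" "\<beta> \<in> carrier G"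
  shows "pairing D \<alpha> (\<alpha> [^] (k::nat) \<otimes> \<beta>) = \<theta> \<alpha> ^ k * pairing D \<alpha> \<beta>"
proof -
  have "snd \<tau> (\<alpha> [^] k \<otimes> \<beta>) = \<theta> \<alpha> ^ k * snd \<tau> \<beta>" if "\<tau> \<in> pairs" "\<alpha> \<in> fst \<tau>" for \<tau>
  proof -
    have \<xi>: "snd \<tau> \<in> dual G" "snd \<tau> \<alpha> = \<theta> \<alpha>"
      using that by (cases \<tau>; simp add: pairs_iff)+
    have "snd \<tau> (\<alpha> [^] k \<otimes> \<beta>) = snd \<tau> (\<alpha> [^] k) * snd \<tau> \<beta>"
      using \<xi>(1) assms by (simp add: dual_iff)
    then show ?thesis using dual_pow[OF \<xi>(1) assms(1)] \<xi>(2) by simp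
  qed
  then show ?thesis
    unfolding pairing_def sum_distrib_left by (intro sum.cong refl) simp
qed

text \<open>The Euclidean algorithm on exponents, each step being a shift followed by a swap.\<close>

lemma pairing_euclid:
  fixes a b :: nat
  assumes sym: "\<And>\<alpha> \<beta>. \<lbrakk>\<alpha> \<in> carrier G; \<beta> \<in> carrier G\<rbrakk> \<Longrightarrow> pairing D \<alpha> \<beta> = pairing D \<beta> \<alpha>"
  shows "\<exists>\<gamma>\<in>carrier G. \<exists>c. pairing D (g [^] a) (g [^] b) = c * pairing D \<gamma> \<one> \<and>
    (\<forall>L. subgroup L G \<longrightarrow> \<gamma> \<in> L \<longrightarrow> g [^] a \<in> L \<and> g [^] b \<in> L)"
proof (induction a b rule: gcd_nat_induct)
  \<comment> \<open>The second exponent is 0, so the second argument is already the unit and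
    \<gamma> is the first one, with factor 1.\<close>
  case (base a)
  show ?case
    using generator subgroup.one_closed by (intro bexI[of _ "g [^] a"] exI[of _ 1]) auto
next
  case (step a b)
  then obtain \<gamma> c where \<gamma>: "\<gamma> \<in> carrier G"
    and eq: "pairing D (g [^] b) (g [^] (a mod b)) = c * pairing D \<gamma> \<one>"
    and mem: "\<And>L. \<lbrakk>subgroup L G; \<gamma> \<in> L\<rbrakk> \<Longrightarrow> g [^] b \<in> L \<and> g [^] (a mod b) \<in> L"
    by blast
  have a: "g [^] a = (g [^] b) [^] (a div b) \<otimes> g [^] (a mod b)"
    using generator by (simp add: nat_pow_pow nat_pow_mult)
  have "pairing D (g [^] a) (g [^] b) = pairing D (g [^] b) (g [^] a)"
    using generator by (intro sym) auto
  also have "\<dots> = \<theta> (g [^] b) ^ (a div b) * c * pairing D \<gamma> \<one>"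
    unfolding a using generator eq by (simp add: pairing_shift)
  finally have "pairing D (g [^] a) (g [^] b) = \<theta> (g [^] b) ^ (a div b) * c * pairing D \<gamma> \<one>" .
  moreover have "g [^] a \<in> L \<and> g [^] b \<in> L" if L: "subgroup L G" "\<gamma> \<in> L" for L
  proof -
    have "(g [^] b) [^] k \<in> L" for k :: nat
      using mem[OF L] L(1) by (induction k) (auto simp: subgroup.m_closed subgroup.one_closed)
    then show ?thesis
      unfolding a using mem[OF L] subgroup.m_closed[OF L(1)] by blast
  qed
  ultimately show ?case using \<gamma> by blast
qed

text \<open>For maximal \<open>K\<close> with \<open>D (K, \<cdot>) \<noteq> 0\<close> and a generator \<open>\<alpha>\<close> of \<open>K\<close>, the function
  \<open>pairing D \<alpha>\<close> vanishes off \<open>K\<close> by the Euclidean algorithm and is a multiple of \<open>\<theta>\<close> on \<open>K\<close>.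
  Hence its Fourier coefficients \<open>D (K, \<xi>)\<close> are all equal.\<close>

lemma symmetric_pairing_eq_0:
  assumes sym: "\<And>\<alpha> \<beta>. \<lbrakk>\<alpha> \<in> carrier G; \<beta> \<in> carrier G\<rbrakk> \<Longrightarrow> pairing D \<alpha> \<beta> = pairing D \<beta> \<alpha>"
    and zero: "\<And>K. subgroup K G \<Longrightarrow> D (K, theta_char) = 0"
    and "(K, \<xi>) \<in> pairs"
  shows "D (K, \<xi>) = 0"
  using assms(3)
\<comment> \<open>Downward induction on the size of K: all strictly larger subgroups are settled,
  which is the sense in which K is maximal.\<close>
proof (induction "order G - card K" arbitrary: K \<xi> rule: less_induct)
  case less
  then have K: "subgroup K G" by (simp add: pairs_iff)
  have finite_subgroup: "finite L" if "subgroup L G" for L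
    using that finite_carrier subgroup.subset finite_subset by blast
  have larger: "D (L, \<xi>) = 0" if "K \<subset> L" "(L, \<xi>) \<in> pairs" for L \<xi>
  proof (rule less.hyps[OF _ that(2)])
    have L: "subgroup L G" using that by (simp add: pairs_iff)
    have "card K < card L"
      using finite_subgroup[OF L] that(1) by (rule psubset_card_mono)
    moreover have "card L \<le> order G"
      unfolding order_def using finite_carrier subgroup.subset[OF L] by (rule card_mono)
    ultimately show "order G - card L < order G - card K" by linarith
  qed
  obtain \<alpha> where \<alpha>: "\<alpha> \<in> K" and principal: "\<And>L. \<lbrakk>subgroup L G; \<alpha> \<in> L\<rbrakk> \<Longrightarrow> K \<subseteq> L"
    using subgroup_principal[OF K] by blast
  have \<alpha>': "\<alpha> \<in> carrier G" using subgroup.mem_carrier[OF K \<alpha>] .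
  define T where "T = {\<xi>. (K, \<xi>) \<in> pairs}"
  have "T \<subseteq> dual G" by (auto simp: T_def pairs_iff)
  then have finT: "finite T" using finite_dual finite_subset by blast
  have fourier: "pairing D \<alpha> \<beta> = (\<Sum>\<xi>\<in>T. D (K, \<xi>) * \<xi> \<beta>)" for \<beta>
  proof -
    have "D \<tau> * (if \<alpha> \<in> fst \<tau> then snd \<tau> \<beta> else 0) = 0" if "\<tau> \<in> pairs - Pair K ` T" for \<tau>
    proof -
      obtain L \<xi> where \<tau>: "\<tau> = (L, \<xi>)" by fastforce
      then have "(L, \<xi>) \<in> pairs" "L \<noteq> K" using that by (auto simp: T_def)
      then show ?thesis
        using principal[of L] larger[of L \<xi>] \<tau> by (auto simp: pairs_iff)
    qed
    then have "pairing D \<alpha> \<beta> = (\<Sum>\<tau>\<in>Pair K ` T. D \<tau> * (if \<alpha> \<in> fst \<tau> then snd \<tau> \<beta> else 0))"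
      unfolding pairing_def using finite_pairs
      by (intro sum.mono_neutral_right) (auto simp: T_def)
    then show ?thesis using \<alpha> by (simp add: sum.reindex inj_on_def)
  qed
  have off: "pairing D \<alpha> \<beta> = 0" if \<beta>: "\<beta> \<in> carrier G" "\<beta> \<notin> K" for \<beta>
  proof -
    obtain a b :: nat where ab: "\<alpha> = g [^] a" "\<beta> = g [^] b"
      using powers \<alpha>' \<beta>(1) by metis
    obtain \<gamma> c where eq: "pairing D \<alpha> \<beta> = c * pairing D \<gamma> \<one>"
      and mem: "\<And>L. \<lbrakk>subgroup L G; \<gamma> \<in> L\<rbrakk> \<Longrightarrow> \<alpha> \<in> L \<and> \<beta> \<in> L"
      using pairing_euclid[OF sym, of a b] unfolding ab by blast
    \<comment> \<open>A subgroup containing \<open>\<gamma>\<close> contains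
      \<open>\<alpha>\<close>, hence K, and also \<open>\<beta>\<close> outside K; it is strictly
      larger than K, where \<open>D\<close> vanishes.\<close>
    have "D \<tau> * (if \<gamma> \<in> fst \<tau> then snd \<tau> \<one> else 0) = 0" if "\<tau> \<in> pairs" for \<tau>
    proof -
      obtain L \<xi> where \<tau>: "\<tau> = (L, \<xi>)" by fastforce
      show ?thesis
      proof (cases "\<gamma> \<in> L")
        case True
        then have "K \<subset> L"
          using mem[of L] principal[of L] \<beta>(2) that by (auto simp: \<tau> pairs_iff)
        then show ?thesis using larger that by (simp add: \<tau>)
      qed (simp add: \<tau>)
    qed
    then have "pairing D \<gamma> \<one> = 0"
      unfolding pairing_def by (intro sum.neutral) blast
    then show ?thesis by (simp add: eq)
  qed
  \<comment> \<open>Characters are 1 at the unit, so \<open>C\<close> is the value of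
    \<open>pairing D \<alpha>\<close> there and thus the factor in front of \<theta> on K.\<close>
  define C where "C = (\<Sum>\<xi>\<in>T. D (K, \<xi>))"
  have coeff: "of_nat (order G) * D (K, \<chi>) = of_nat (card K) * C" if \<chi>: "\<chi> \<in> T" for \<chi>
  proof -
    have \<chi>': "\<chi> \<in> dual G" "\<And>\<beta>. \<beta> \<in> K \<Longrightarrow> \<chi> \<beta> = \<theta> \<beta>"
      using \<chi> by (auto simp: T_def pairs_iff)
    have "(\<Sum>\<beta>\<in>carrier G. pairing D \<alpha> \<beta> / \<chi> \<beta>) = (\<Sum>\<beta>\<in>K. pairing D \<alpha> \<beta> / \<chi> \<beta>)"
      using finite_carrier subgroup.subset[OF K] off by (intro sum.mono_neutral_right) auto
    also have "\<dots> = (\<Sum>\<beta>\<in>K. C)"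
    proof (rule sum.cong[OF refl])
      fix \<beta> assume \<beta>: "\<beta> \<in> K"
      have "pairing D \<alpha> \<beta> = C * \<theta> \<beta>"
        unfolding fourier C_def sum_distrib_right using \<beta> by (auto simp: T_def pairs_iff intro: sum.cong)
      then show "pairing D \<alpha> \<beta> / \<chi> \<beta> = C"
        using \<chi>'(2)[OF \<beta>] theta_nonzero[OF subgroup.mem_carrier[OF K \<beta>]] by simp
    qed
    finally have "of_nat (card K) * C = (\<Sum>\<beta>\<in>carrier G. pairing D \<alpha> \<beta> / \<chi> \<beta>)" by simp
    also have "\<dots> = (\<Sum>\<xi>\<in>T. D (K, \<xi>) * (\<Sum>\<beta>\<in>carrier G. \<xi> \<beta> / \<chi> \<beta>))"
      unfolding fourier sum_divide_distrib sum_distrib_left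
      by (subst sum.swap) (simp add: mult.assoc)
    also have "\<dots> = (\<Sum>\<xi>\<in>T. D (K, \<xi>) * (if \<xi> = \<chi> then of_nat (order G) else 0))"
      using \<open>T \<subseteq> dual G\<close> \<chi>'(1)
      by (intro sum.cong refl arg_cong2[of _ _ _ _ "(*)"] dual_orthogonality) auto
    also have "\<dots> = of_nat (order G) * D (K, \<chi>)"
      using finT \<chi> by (simp add: if_distrib[of "\<lambda>x. _ * x"] mult.commute cong: if_cong)
    finally show ?thesis by simp
  qed
  \<comment> \<open>The common value of the coefficients is read off at \<open>theta_char\<close>,
    where \<open>D\<close> vanishes by assumption.\<close>
  have "of_nat (card K) * C = 0"
    using coeff[of theta_char] theta_pair[OF K] zero[OF K] by (simp add: T_def)
  with coeff[of \<xi>] less.prems show ?case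
    using order_pos by (simp add: T_def)
qed

text \<open>If no type (K, \<theta>) occurred, \<open>symmetric_pairing_eq_0\<close> would make all
  counts vanish. A count that occurs is a positive multiple of the index.\<close>

lemma admissible_nonempty_theta:
  assumes \<Psi>: "admissible G \<theta> \<Psi>" and "support \<Psi> \<noteq> {}"
  obtains K where "subgroup K G" "index K \<le> type_count \<Psi> (K, theta_char)"
proof -
  have wpa: "wpa \<Psi>" and adm: "admissible_count (type_count \<Psi>)"
    using \<Psi> by (auto simp: admissible_iff)
  obtain K where K: "subgroup K G" "type_count \<Psi> (K, theta_char) \<noteq> 0"
  proof (rule ccontr)
    assume "\<not> thesis"
    with that have zero: "type_count \<Psi> (K, theta_char) = 0" if "subgroup K G" for K
      using \<open>subgroup K G\<close> by blast
    have "type_count \<Psi> \<tau> = 0" if "\<tau> \<in> pairs" for \<tau>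
      using symmetric_pairing_eq_0[of "\<lambda>\<tau>. of_nat (type_count \<Psi> \<tau>)" "fst \<tau>" "snd \<tau>"] adm zero that
      by (simp add: admissible_count_def)
    then have "card (support \<Psi>) = 0"
      by (simp add: card_support_eq_sum_types[OF wpa])
    then show False using wpa_finite[OF wpa] assms(2) by simp
  qed
  moreover obtain mu where "type_count \<Psi> (K, theta_char) = mu * index K"
    using adm theta_pair[OF K(1)] unfolding admissible_count_def galois_count_def by fast
  ultimately show ?thesis using that[OF K(1)] by simp
qed

text \<open>Each of two non-empty admissible summands would need a type (K, \<theta>), and A[H]
  offers only K = H. That requires at least \<open>2 * index H\<close> points of type (H, \<theta>),
  while there are only \<open>index H\<close>.\<close>

lemma irreducible_if_equiv_adm_coset_wpa:
  fixes \<Phi> :: "('a, 'x) wpa"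
  assumes H: "subgroup H G" and \<Phi>: "wpa \<Phi>" and equiv: "wpa_equiv G \<Phi> (adm_coset_wpa G \<theta> H)"
  shows "irreducible_wpa G \<theta> \<Phi>"
proof -
  have count: "type_count \<Phi> \<tau> = type_count (adm_coset_wpa G \<theta> H) \<tau>" if "\<tau> \<in> pairs" for \<tau>
    using equiv that by (simp add: wpa_equiv_iff_type_count[OF \<Phi> wpa_adm_coset_wpa[OF H]])
  have theta: "type_count \<Phi> (K, theta_char) = (if K = H then index H else 0)" if "subgroup K G" for K
    using count[OF theta_pair[OF that]] by (simp add: type_count_adm_coset_wpa_theta[OF H])
  have "support \<Phi> \<noteq> {}"
    using theta[OF H] index_pos[OF H] by (auto simp: type_count_def)
  moreover have "\<not> wpa_equiv G \<Phi> (wpa_plus \<Psi>\<^sub>1 \<Psi>\<^sub>2)"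
    if \<Psi>\<^sub>1: "admissible G \<theta> \<Psi>\<^sub>1" "support \<Psi>\<^sub>1 \<noteq> {}" and \<Psi>\<^sub>2: "admissible G \<theta> \<Psi>\<^sub>2" "support \<Psi>\<^sub>2 \<noteq> {}"
    for \<Psi>\<^sub>1 \<Psi>\<^sub>2 :: "('a, 'x) wpa"
  proof
    assume "wpa_equiv G \<Phi> (wpa_plus \<Psi>\<^sub>1 \<Psi>\<^sub>2)"
    then have sum: "type_count \<Phi> \<tau> = type_count \<Psi>\<^sub>1 \<tau> + type_count \<Psi>\<^sub>2 \<tau>" if "\<tau> \<in> pairs" for \<tau>
      using \<Psi>\<^sub>1 \<Psi>\<^sub>2 \<Phi> that
      by (auto simp: admissible_iff wpa_equiv_iff_type_count wpa_plus_wpa type_count_plus)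
    obtain K\<^sub>1 where K\<^sub>1: "subgroup K\<^sub>1 G" "index K\<^sub>1 \<le> type_count \<Psi>\<^sub>1 (K\<^sub>1, theta_char)"
      using admissible_nonempty_theta[OF \<Psi>\<^sub>1] by blast
    obtain K\<^sub>2 where K\<^sub>2: "subgroup K\<^sub>2 G" "index K\<^sub>2 \<le> type_count \<Psi>\<^sub>2 (K\<^sub>2, theta_char)"
      using admissible_nonempty_theta[OF \<Psi>\<^sub>2] by blast
    have "K\<^sub>1 = H" "K\<^sub>2 = H"
      using sum[OF theta_pair[OF K\<^sub>1(1)]] sum[OF theta_pair[OF K\<^sub>2(1)]] theta[OF K\<^sub>1(1)] theta[OF K\<^sub>2(1)]
        K\<^sub>1(2) K\<^sub>2(2) index_pos[OF K\<^sub>1(1)] index_pos[OF K\<^sub>2(1)]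
      by (auto split: if_splits)
    then have "2 * index H \<le> type_count \<Phi> (H, theta_char)"
      using K\<^sub>1(2) K\<^sub>2(2) sum[OF theta_pair[OF H]] by simp
    then show False using theta[OF H] index_pos[OF H] by simp
  qed
  ultimately show ?thesis
    unfolding irreducible_wpa_def
    using admissible_equiv[OF \<Phi> admissible_adm_coset_wpa[OF H] equiv] by blast
qed

section \<open>Sums of admissible coset actions and the classification\<close>

context
  fixes H :: "nat \<Rightarrow> 'a set"
  assumes H: "\<And>l. l dvd order G \<Longrightarrow> subgroup (H l) G \<and> card (H l) = l"
begin

definition combination ::
    "(nat \<Rightarrow> nat) \<Rightarrow> ('a, nat \<times> nat \<times> ('a set \<times> ('a \<Rightarrow> complex)) \<times> 'a set) wpa" where
  "combination m = wpa_sum {l. l dvd order G} (\<lambda>l. wpa_copies (m l) (adm_coset_wpa G \<theta> (H l)))"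

lemma finite_divisors: "finite {l. l dvd order G}"
  using order_pos by simp

lemma admissible_combination: "admissible G \<theta> (combination m)"
  unfolding combination_def using H
  by (intro admissible_sum finite_divisors admissible_copies admissible_adm_coset_wpa) auto

lemma type_count_combination:
  "type_count (combination m) \<tau> =
    (\<Sum>l | l dvd order G. m l * type_count (adm_coset_wpa G \<theta> (H l)) \<tau>)"
  unfolding combination_def using H
  by (subst type_count_sum[OF finite_divisors])
     (auto intro!: sum.cong simp: wpa_copies_wpa wpa_adm_coset_wpa type_count_copies)

lemma subgroup_eq_H:
  assumes K: "subgroup K G"
  shows "card K dvd order G" "K = H (card K)"
proof -
  show "card K dvd order G" using card_mult_index[OF K] by (metis dvd_triv_left)
  then show "K = H (card K)"
    using H[of "card K"] by (intro subgroup_eq_of_card_eq[OF K]) auto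
qed

text \<open>The system is diagonal: the coordinate (K, \<theta>) sees only the summand with l =
  \<open>card K\<close>, so the coefficients can be prescribed one by one.\<close>

lemma type_count_combination_theta:
  assumes K: "subgroup K G"
  shows "type_count (combination m) (K, theta_char) = m (card K) * index K"
proof -
  have "type_count (combination m) (K, theta_char) =
      (\<Sum>l | l dvd order G. if l = card K then m l * index K else 0)"
    unfolding type_count_combination
    using H subgroup_eq_H[OF K] by (intro sum.cong refl) (auto simp: type_count_adm_coset_wpa_theta)
  then show ?thesis
    using finite_divisors subgroup_eq_H(1)[OF K] by simp
qed

lemma admissible_equiv_combination:
  assumes \<Phi>: "admissible G \<theta> \<Phi>"
  obtains m where "wpa_equiv G \<Phi> (combination m)"
proof -
  have wpa: "wpa \<Phi>" and adm: "admissible_count (type_count \<Phi>)"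
    using \<Phi> by (auto simp: admissible_iff)
  have wpa': "wpa (combination m)" and adm': "admissible_count (type_count (combination m))" for m
    using admissible_combination[of m] by (auto simp: admissible_iff)
  obtain mu where mu: "\<And>K \<xi>. (K, \<xi>) \<in> pairs \<Longrightarrow> type_count \<Phi> (K, \<xi>) = mu K \<xi> * index K"
    using adm unfolding admissible_count_def galois_count_def by fast
  define m where "m l = mu (H l) theta_char" for l
  \<comment> \<open>The difference may take negative values. It inherits symmetry of the pairing,
    and the choice of \<open>m\<close> makes it vanish at all (K, \<theta>).\<close>
  define D :: "'a set \<times> ('a \<Rightarrow> complex) \<Rightarrow> complex" where
    "D \<tau> = of_nat (type_count \<Phi> \<tau>) - of_nat (type_count (combination m) \<tau>)" for \<tau>
  have "pairing D \<alpha> \<beta> = pairing (type_count \<Phi>) \<alpha> \<beta> - pairing (type_count (combination m)) \<alpha> \<beta>" for \<alpha> \<beta>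
    by (simp add: pairing_def D_def left_diff_distrib sum_subtractf)
  then have "pairing D \<alpha> \<beta> = pairing D \<beta> \<alpha>" if "\<alpha> \<in> carrier G" "\<beta> \<in> carrier G" for \<alpha> \<beta>
    using that adm adm'[of m] by (simp add: admissible_count_def)
  moreover have "D (K, theta_char) = 0" if "subgroup K G" for K
    using mu[OF theta_pair[OF that]] subgroup_eq_H(2)[OF that]
    by (simp add: D_def type_count_combination_theta[OF that] m_def)
  ultimately have "D (K, \<xi>) = 0" if "(K, \<xi>) \<in> pairs" for K \<xi>
    using symmetric_pairing_eq_0[of D] that by blast
  then have "type_count \<Phi> \<tau> = type_count (combination m) \<tau>" if "\<tau> \<in> pairs" for \<tau>
    using that by (cases \<tau>) (simp add: D_def)
  then show ?thesis
    using that[of m] wpa_equiv_iff_type_count[OF wpa wpa'] by blast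
qed

text \<open>One copy of some A[H] is split off the decomposition; what remains is again a
  \<open>combination\<close>, hence admissible, so irreducibility forces it to be empty.\<close>

lemma irreducible_equiv_adm_coset_wpa:
  fixes \<Phi> :: "('a, 'x) wpa"
  assumes irr: "irreducible_wpa G \<theta> \<Phi>"
  shows "\<exists>l. l dvd order G \<and> wpa_equiv G \<Phi> (adm_coset_wpa G \<theta> (H l))"
proof -
  have adm: "admissible G \<theta> \<Phi>" and ne: "support \<Phi> \<noteq> {}"
    using irr by (auto simp: irreducible_wpa_def)
  then have wpa: "wpa \<Phi>" by (simp add: admissible_iff)
  have wpaC: "wpa (combination m)" for m
    using admissible_combination[of m] by (simp add: admissible_iff)
  obtain m where m: "\<And>\<tau>. \<tau> \<in> pairs \<Longrightarrow> type_count \<Phi> \<tau> = type_count (combination m) \<tau>"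
    using admissible_equiv_combination[OF adm] wpa_equiv_iff_type_count[OF wpa wpaC] by metis
  have "\<exists>l. l dvd order G \<and> m l \<noteq> 0"
  proof (rule ccontr)
    assume "\<not> ?thesis"
    then have "type_count \<Phi> \<tau> = 0" if "\<tau> \<in> pairs" for \<tau>
      using m[OF that] by (simp add: type_count_combination)
    then show False
      using card_support_eq_sum_types[OF wpa] wpa_finite[OF wpa] ne by simp
  qed
  then obtain l where l: "l dvd order G" "m l \<noteq> 0" by blast
  define A where "A = adm_coset_wpa G \<theta> (H l)"
  define m' where "m' = m(l := m l - 1)"
  define B where "B = combination m'"
  have A: "admissible G \<theta> A" "wpa A"
    using H[OF l(1)] by (simp_all add: A_def admissible_adm_coset_wpa wpa_adm_coset_wpa)
  have B: "admissible G \<theta> B" "wpa B"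
    by (simp_all add: B_def admissible_combination wpaC)
  have AB: "type_count \<Phi> \<tau> = type_count A \<tau> + type_count B \<tau>" if "\<tau> \<in> pairs" for \<tau>
  proof -
    have m_eq: "m k = m' k + (if k = l then 1 else 0)" for k
      using l(2) by (simp add: m'_def)
    have "type_count (combination m) \<tau> = (\<Sum>k | k dvd order G.
        m' k * type_count (adm_coset_wpa G \<theta> (H k)) \<tau> + (if k = l then type_count A \<tau> else 0))"
      unfolding type_count_combination
      by (intro sum.cong refl) (auto simp: m_eq A_def distrib_right)
    then show ?thesis
      using l(1) finite_divisors m[OF that]
      by (simp add: sum.distrib B_def type_count_combination)
  qed
  have neA: "support A \<noteq> {}"
    using irreducible_if_equiv_adm_coset_wpa[of "H l" A] H[OF l(1)] A(2)
    by (auto simp: irreducible_wpa_def A_def wpa_equiv_iff_type_count)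
  have "support B = {}"
  proof (rule ccontr)
    assume neB: "support B \<noteq> {}"
    \<comment> \<open>Both summands have to be moved to the type of points of \<open>\<Phi>\<close>.
      By this count its support has subsets of the two sizes; they may overlap, since
      \<open>wpa_plus\<close> takes a disjoint union.\<close>
    have card: "card (support \<Phi>) = card (support A) + card (support B)"
      by (simp add: card_support_eq_sum_types wpa A B AB sum.distrib)
    obtain S\<^sub>1 :: "'x set" where S\<^sub>1: "finite S\<^sub>1" "card S\<^sub>1 = card (support A)"
      using obtain_subset_with_card_n[of "card (support A)" "support \<Phi>"] card by auto
    obtain S\<^sub>2 :: "'x set" where S\<^sub>2: "finite S\<^sub>2" "card S\<^sub>2 = card (support B)"
      using obtain_subset_with_card_n[of "card (support B)" "support \<Phi>"] card by auto
    obtain \<Psi>\<^sub>1 :: "('a, 'x) wpa" where \<Psi>\<^sub>1: "wpa \<Psi>\<^sub>1" "support \<Psi>\<^sub>1 = S\<^sub>1"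
      "\<And>\<tau>. type_count \<Psi>\<^sub>1 \<tau> = type_count A \<tau>"
      using ex_wpa_on_support[OF A(2) S\<^sub>1] by blast
    obtain \<Psi>\<^sub>2 :: "('a, 'x) wpa" where \<Psi>\<^sub>2: "wpa \<Psi>\<^sub>2" "support \<Psi>\<^sub>2 = S\<^sub>2"
      "\<And>\<tau>. type_count \<Psi>\<^sub>2 \<tau> = type_count B \<tau>"
      using ex_wpa_on_support[OF B(2) S\<^sub>2] by blast
    have "admissible G \<theta> \<Psi>\<^sub>1" "admissible G \<theta> \<Psi>\<^sub>2"
      using admissible_equiv[OF \<Psi>\<^sub>1(1) A(1)] admissible_equiv[OF \<Psi>\<^sub>2(1) B(1)]
      by (simp_all add: wpa_equiv_iff_type_count A B \<Psi>\<^sub>1 \<Psi>\<^sub>2)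
    moreover have "support \<Psi>\<^sub>1 \<noteq> {}" "support \<Psi>\<^sub>2 \<noteq> {}"
      using S\<^sub>1 S\<^sub>2 neA neB \<Psi>\<^sub>1(2) \<Psi>\<^sub>2(2) wpa_finite[OF A(2)] wpa_finite[OF B(2)] by auto
    moreover have "wpa_equiv G \<Phi> (wpa_plus \<Psi>\<^sub>1 \<Psi>\<^sub>2)"
      by (simp add: wpa_equiv_iff_type_count wpa \<Psi>\<^sub>1 \<Psi>\<^sub>2 wpa_plus_wpa type_count_plus AB)
    ultimately show False
      using irr unfolding irreducible_wpa_def by blast
  qed
  then have "type_count B \<tau> = 0" for \<tau> by (simp add: type_count_def)
  then have "wpa_equiv G \<Phi> A"
    by (simp add: wpa_equiv_iff_type_count wpa A AB)
  then show ?thesis using l(1) by (auto simp: A_def)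
qed

text \<open>The subgroup of order l is generated by the power of the generator with exponent
  \<open>order G div l\<close>, so triviality of \<theta> is tested on that element.\<close>

lemma even_part_H_eq_iff:
  assumes "l dvd order G"
  shows "even_part (H l) = H l \<longleftrightarrow> \<theta> (g [^] (order G div l)) = 1"
proof -
  have Hl: "subgroup (H l) G" "card (H l) = l" using H[OF assms] by auto
  have index: "index (H l) = order G div l"
    using index_eq[OF Hl(1)] Hl(2) by simp
  show ?thesis
  proof
    assume "even_part (H l) = H l"
    then show "\<theta> (g [^] (order G div l)) = 1"
      using mem_even_part[OF Hl(1)] pow_generator_mem_iff[OF Hl(1)] by (metis dvd_refl index)
  next
    assume 1: "\<theta> (g [^] (order G div l)) = 1"
    have "\<theta> \<alpha> = 1" if \<alpha>: "\<alpha> \<in> H l" for \<alpha>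
    proof -
      obtain i :: nat where i: "\<alpha> = g [^] i"
        using powers subgroup.mem_carrier[OF Hl(1) \<alpha>] by blast
      then obtain j where "i = (order G div l) * j"
        using \<alpha> pow_generator_mem_iff[OF Hl(1)] index by auto
      then show ?thesis
        using i 1 generator by (simp add: theta_pow power_mult)
    qed
    then show "even_part (H l) = H l"
      using mem_even_part[OF Hl(1)] by auto
  qed
qed

lemma degree_adm_coset_wpa_H:
  assumes "l dvd order G"
  shows "wpa_degree (adm_coset_wpa G \<theta> (H l)) =
    (if \<theta> g ^ (order G div l) = 1 then 1 else 3) * (order G div l)\<^sup>2"
proof -
  have Hl: "subgroup (H l) G" "card (H l) = l" using H[OF assms] by auto
  have "index (H l) = order G div l"
    using index_eq[OF Hl(1)] Hl(2) by simp
  then show ?thesis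
    using degree_adm_coset_wpa[OF Hl(1)] even_part_H_eq_iff[OF assms]
    by (simp add: theta_pow generator)
qed

lemma ex_wpa_equiv_combination:
  assumes "admissible G \<theta> \<Phi>"
  shows "\<exists>m. wpa_equiv G \<Phi>
    (wpa_sum {l. l dvd order G} (\<lambda>l. wpa_copies (m l) (adm_coset_wpa G \<theta> (H l))))"
  using admissible_equiv_combination[OF assms] unfolding combination_def by metis

lemma irreducible_adm_coset_wpa:
  assumes "l dvd order G"
  shows "irreducible_wpa G \<theta> (adm_coset_wpa G \<theta> (H l))"
  using H[OF assms] by (intro irreducible_if_equiv_adm_coset_wpa[of "H l"])
    (simp_all add: wpa_adm_coset_wpa wpa_equiv_iff_type_count)

lemma irreducible_iff_equiv_adm_coset_wpa:
  assumes "wpa \<Phi>"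
  shows "irreducible_wpa G \<theta> \<Phi> \<longleftrightarrow>
    (\<exists>l. l dvd order G \<and> wpa_equiv G \<Phi> (adm_coset_wpa G \<theta> (H l)))"
  using irreducible_equiv_adm_coset_wpa[of \<Phi>] irreducible_if_equiv_adm_coset_wpa[OF _ assms] H
  by blast

end

end

text \<open>The values of \<theta> are signs because \<theta> of a square is the fourth power of
  \<theta> \<alpha> by the quadratic law and its second power by multiplicativity.\<close>

lemma cyclic_degenerate_groupI:
  assumes "quadratic_group G \<theta>" "completely_degenerate G \<theta>"
    and g: "g \<in> carrier G" "generate G {g} = carrier G"
  shows "cyclic_degenerate_group G \<theta> g"
proof -
  interpret comm_group G using assms(1) unfolding quadratic_group_def by blast
  have fin: "finite (carrier G)" using assms(1) unfolding quadratic_group_def by blast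
  have mult: "\<theta> (\<alpha> \<otimes>\<^bsub>G\<^esub> \<beta>) = \<theta> \<alpha> * \<theta> \<beta>" if "\<alpha> \<in> carrier G" "\<beta> \<in> carrier G" for \<alpha> \<beta>
    using assms(2) that by (simp add: completely_degenerate_def)
  have square: "\<theta> \<alpha> * \<theta> \<alpha> = 1" if \<alpha>: "\<alpha> \<in> carrier G" for \<alpha>
  proof -
    have nz: "\<theta> \<alpha> \<noteq> 0" and pow: "\<theta> (\<alpha> [^]\<^bsub>G\<^esub> (2::int)) = \<theta> \<alpha> powi (2\<^sup>2)"
      using assms(1) \<alpha> unfolding quadratic_group_def by blast+
    have "\<alpha> [^]\<^bsub>G\<^esub> (2::int) = \<alpha> \<otimes>\<^bsub>G\<^esub> \<alpha>"
      using int_pow_mult[OF \<alpha>, of 1 1] \<alpha> by (simp add: int_pow_1)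
    then have "(\<theta> \<alpha> * \<theta> \<alpha>) * (\<theta> \<alpha> * \<theta> \<alpha>) = \<theta> \<alpha> * \<theta> \<alpha>"
      using pow mult[OF \<alpha> \<alpha>] by (simp add: power_int_def numeral_eq_Suc mult.assoc)
    then show ?thesis using nz by simp
  qed
  have "\<exists>i::nat. \<alpha> = g [^]\<^bsub>G\<^esub> i" if "\<alpha> \<in> carrier G" for \<alpha>
    using that generate_pow_on_finite_carrier[OF fin g(1)] g(2) by auto
  then show ?thesis
    by unfold_locales (use fin mult square g in auto)
qed

theorem mainTheorem2:
  fixes G :: "('a, 'm) monoid_scheme"
    and \<theta> :: "'a \<Rightarrow> complex"
    and n :: nat
    and H :: "nat \<Rightarrow> 'a set"
  assumes "n \<ge> 1"
    and "cyclic_group G" and "order G = n"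
    and "quadratic_group G \<theta>" and "completely_degenerate G \<theta>"
    and "\<And>l. l dvd n \<Longrightarrow> subgroup (H l) G \<and> card (H l) = l"
  shows
    "(\<forall>\<Phi> :: ('a, 'x) wpa. admissible G \<theta> \<Phi> \<longrightarrow>
        (\<exists>m :: nat \<Rightarrow> nat.
           wpa_equiv G \<Phi> (wpa_sum {l. l dvd n} (\<lambda>l. wpa_copies (m l) (adm_coset_wpa G \<theta> (H l))))))
     \<and>
     ((\<forall>l. l dvd n \<longrightarrow> irreducible_wpa G \<theta> (adm_coset_wpa G \<theta> (H l))) \<and>
      (\<forall>\<Phi> :: ('a, 'x) wpa. is_wpa G \<theta> \<Phi> \<longrightarrow>
         (irreducible_wpa G \<theta> \<Phi> \<longleftrightarrow> (\<exists>l. l dvd n \<and> wpa_equiv G \<Phi> (adm_coset_wpa G \<theta> (H l))))))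
     \<and>
     (\<forall>\<alpha>\<in>carrier G. generate G {\<alpha>} = carrier G \<longrightarrow>
        (\<theta> \<alpha> = 1 \<longrightarrow> (\<forall>l. l dvd n \<longrightarrow> wpa_degree (adm_coset_wpa G \<theta> (H l)) = (n div l)\<^sup>2)) \<and>
        (\<theta> \<alpha> = -1 \<longrightarrow> even n \<and>
           (\<forall>l. l dvd n \<longrightarrow>
              (l dvd n div 2 \<longrightarrow> wpa_degree (adm_coset_wpa G \<theta> (H l)) = (n div l)\<^sup>2) \<and>
              (\<not> l dvd n div 2 \<longrightarrow> wpa_degree (adm_coset_wpa G \<theta> (H l)) = 3 * (n div l)\<^sup>2) \<and>
              (\<not> l dvd n div 2 \<longleftrightarrow> odd (n div l)))))"
proof -
  note order = assms(3) and H = assms(6)[folded assms(3)]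
  interpret comm_group G using assms(4) unfolding quadratic_group_def by blast
  obtain g where g: "g \<in> carrier G" and range: "carrier G = range (\<lambda>i::int. g [^]\<^bsub>G\<^esub> i)"
    using assms(2) unfolding cyclic_group by blast
  have "generate G {g} = carrier G"
    unfolding generate_pow[OF g] by (subst range) auto
  with assms(4,5) g have cyclic: "cyclic_degenerate_group G \<theta> g"
    by (rule cyclic_degenerate_groupI)
  note decomposition = cyclic_degenerate_group.ex_wpa_equiv_combination[OF cyclic H, unfolded order]
    and irreducible = cyclic_degenerate_group.irreducible_adm_coset_wpa[OF cyclic H, unfolded order]
    and classification =
      cyclic_degenerate_group.irreducible_iff_equiv_adm_coset_wpa[OF cyclic H, unfolded order]
  \<comment> \<open>The locale is instantiated anew with \<open>\<alpha>\<close> as the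
    distinguished generator, since the degree formula is claimed for every generator.\<close>
  have degree: "wpa_degree (adm_coset_wpa G \<theta> (H l)) = (if \<theta> \<alpha> ^ (n div l) = 1 then 1 else 3) * (n div l)\<^sup>2"
    if "\<alpha> \<in> carrier G" "generate G {\<alpha>} = carrier G" "l dvd n" for \<alpha> l
    using cyclic_degenerate_group.degree_adm_coset_wpa_H[OF cyclic_degenerate_groupI, of G \<theta> \<alpha> H l]
      assms(4,5) that H unfolding order by blast
  have even: "even n" if "\<alpha> \<in> carrier G" "\<theta> \<alpha> = - 1" for \<alpha>
    using degenerate_group.even_order[OF cyclic_degenerate_group.axioms(1)[OF cyclic] that]
    unfolding order .
  \<comment> \<open>For \<theta> \<alpha> = -1 the degree formula tests the parity of
    \<open>n div l\<close>; this converts it into divisibility of \<open>n div 2\<close> by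
    l.\<close>
  have half: "l dvd n div 2 \<longleftrightarrow> even (n div l)" if n: "even n" and l: "l dvd n" for l
  proof -
    obtain q where q: "n = l * q" using l by blast
    then have "0 < l" using assms(1) by (cases "l = 0") auto
    have "l dvd n div 2 \<longleftrightarrow> l * 2 dvd n"
      using n by (simp add: dvd_div_iff_mult)
    also have "\<dots> \<longleftrightarrow> even (n div l)"
      using q \<open>0 < l\<close> by simp
    finally show ?thesis .
  qed
  show ?thesis
  proof (intro conjI allI ballI impI)
    fix \<alpha> assume \<alpha>: "\<alpha> \<in> carrier G" "generate G {\<alpha>} = carrier G"
    show "wpa_degree (adm_coset_wpa G \<theta> (H l)) = (n div l)\<^sup>2" if "\<theta> \<alpha> = 1" "l dvd n" for l
      using degree[OF \<alpha> that(2)] that(1) by simp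
    assume minus: "\<theta> \<alpha> = - 1"
    show "even n" using even[OF \<alpha>(1) minus] .
    fix l assume l: "l dvd n"
    show "\<not> l dvd n div 2 \<longleftrightarrow> odd (n div l)"
      using half[OF \<open>even n\<close> l] by simp
    show "wpa_degree (adm_coset_wpa G \<theta> (H l)) = (n div l)\<^sup>2" if "l dvd n div 2"
      using degree[OF \<alpha> l] that half[OF \<open>even n\<close> l] minus by simp
    show "wpa_degree (adm_coset_wpa G \<theta> (H l)) = 3 * (n div l)\<^sup>2" if "\<not> l dvd n div 2"
      using degree[OF \<alpha> l] that half[OF \<open>even n\<close> l] minus by simp
  qed (use decomposition irreducible classification in blast)+
qed

end
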